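(* Let $L=\mathbb{Q}(\alpha)$ be a cubic number field, where $\alpha$ is a root of $f(x)=x^3-ax+b$ with $a,b\in\mathbb{Z}$ such that for every prime $p$ one has $v_p(a)<2$ or $v_p(b)<3$. Let $g=\gcd(a,b)$, let $H$ be the unique Hopf-Galois structure on $L$, with $\mathbb{Q}$-basis $W=\{w_1,w_2,w_3\}$, $w_1=\mathrm{Id}$, $w_2=z(\sigma-\sigma^2)$, $w_3=\sigma+\sigma^2$. Suppose that $B=\{1,\alpha,\alpha^2\}$ is an integral basis of $L$ and that $3\mid a$. Then the index $I_W(\mathbb{Z}[\alpha])$ and a $\mathbb{Z}$-basis of $\mathfrak{A}_H(\mathbb{Z}[\alpha])$ are as follows: 1. If $v_2(a)\ge v_2(b)$ and $v_3(a)\le v_3(b)$: $I_W(\mathbb{Z}[\alpha])=18g$, basis $\left\{w_1,\frac{w_2}{3g},\frac{-2gw_1-w_2+gw_3}{6g}\right\}$. 2. If $v_2(a)<v_2(b)$ and $v_3(a)\le v_3(b)$: $I_W(\mathbb{Z}[\alpha])=18g$, basis $\left\{w_1,\frac{w_2}{6g},\frac{-2w_1+w_3}{3}\right\}$. 3. If $v_2(a)\ge v_2(b)$ and $v_3(a)>v_3(b)$: $I_W(\mathbb{Z}[\alpha])=54g$, basis $\left\{w_1,\frac{w_2}{9g},\frac{-6gw_1-w_2+3gw_3}{18g}\right\}$. 4. If $v_2(a)<v_2(b)$ and $v_3(a)>v_3(b)$: $I_W(\mathbb{Z}[\alpha])=54g$, basis $\left\{w_1,\frac{w_2}{18g},\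frac{-2w_1+w_3}{3}\right\}$.
   Context: $v_p$ is the $p$-adic valuation, with $v_p(0)=\infty$. An integral basis of $L$ is a $\mathbb{Z}$-basis of its ring of integers. Let $\widetilde{L}$ be the normal closure of $L$, $G=\mathrm{Gal}(\widetilde L/\mathbb{Q})$, $G'=\mathrm{Gal}(\widetilde L/L)$, $\alpha_1=\alpha,\alpha_2,\alpha_3\in\widetilde L$ the roots of $f$, $z=\sqrt{4a^3-27b^2}\in\widetilde L$, $M=\mathbb{Q}(z)$, and $\sigma\in G$ the element acting on the roots as the cycle $(\alpha_1,\alpha_2,\alpha_3)$; $J=\langle\sigma\rangle$. The unique Hopf-Galois structure on $L$ is $H=M[J]^{G'}$, where $G'$ acts on $M$ by Galois action and on $J$ by conjugation; $h=\sum_ih_i\sigma^i\in H$ acts on $x\in L$ by $h\cdot x=\sum_ih_i\sigma^i(x)$ (if $L/\mathbb{Q}$ is Galois, $H=\mathbb{Q}[G]$). The associated order is $\mathfrak{A}_H(\mathbb{Z}[\alpha])=\{h\in H\mid h\cdot\mathbb{Z}[\alpha]\subseteq\mathbb{Z}[\alpha]\}$. $I_W(\mathbb{Z}[\alpha])$ is the (generalized) index $[\mathfrak{A}_H(\mathbb{Z}[\alpha]):\langle W\rangle_{\mathbb{Z}}]$, i.e. the absolute value of the determinant of the matrix expressing $W$ in terms of a $\mathbb{Z}$-basis of $\mathfrak{A}_H(\mathbb{Z}[\alpha])$. *)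

theory Defs
  imports
    "HOL-Analysis.Analysis"
    "HOL-Algebra.Algebra"
    "HOL-Algebra.Algebraic_Closure_Type"
    "HOL-Library.Poly_Mapping"
    "HOL-Library.Extended_Nat"
begin

text \<open>Number fields are realised as subfields of the complex numbers.\<close>

abbreviation CC :: "complex ring" where
  "CC \<equiv> ring_of_type_algebra"

text \<open>\<open>\<rat>(S)\<close>, the subfield of the complex numbers generated by \<open>S\<close>, and \<open>\<int>[x]\<close>.\<close>

definition Q_adjoin :: "complex set \<Rightarrow> complex set" where
  "Q_adjoin S = generate_field CC S"

definition Z_adjoin :: "complex \<Rightarrow> complex set" where
  "Z_adjoin x = generate_ring CC {x}"

definition ring_of_integers :: "complex set \<Rightarrow> complex set" where
  "ring_of_integers L = {x \<in> L. algebraic_int x}"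

text \<open>The normal closure of \<open>L\<close> over \<open>\<rat>\<close> is the compositum of the conjugate fields of \<open>L\<close>.\<close>

definition normal_closure :: "complex set \<Rightarrow> complex set" where
  "normal_closure L = Q_adjoin (\<Union>\<phi>\<in>ring_hom (CC\<lparr>carrier := L\<rparr>) CC. \<phi> ` L)"

text \<open>Automorphisms of \<open>E\<close> are extensional functions, so that they are elements of the
  group \<open>BijGroup E\<close> and are determined by their values on \<open>E\<close>.\<close>

definition Gal :: "complex set \<Rightarrow> complex set \<Rightarrow> (complex \<Rightarrow> complex) set" where
  "Gal E F = {\<tau> \<in> extensional E \<inter> ring_iso (CC\<lparr>carrier := E\<rparr>) (CC\<lparr>carrier := E\<rparr>).
                \<forall>x\<in>F. \<tau> x = x}"

text \<open>The normalisation \<open>v\<^sub>p(0) = \<infinity>\<close> differs from the library, where \<open>multiplicity p 0 = 0\<close>.\<close>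

definition vp :: "nat \<Rightarrow> int \<Rightarrow> enat" where
  "vp p n = (if n = 0 then \<infinity> else enat (multiplicity (int p) n))"

text \<open>\<open>b\<close> is an ordered basis of \<open>A\<close>, as a module over the scalars acting through \<open>smul\<close>.
  Injectivity is needed because \<open>dependent\<close> only sees the set of members of the family.\<close>

definition basis_of ::
    "('r::comm_ring_1 \<Rightarrow> 'v::ab_group_add \<Rightarrow> 'v) \<Rightarrow> 'v ^ 'n \<Rightarrow> 'v set \<Rightarrow> bool" where
  "basis_of smul b A \<longleftrightarrow>
     inj (vec_nth b) \<and> \<not> Modules.module.dependent smul (range (vec_nth b)) \<and>
     Modules.module.span smul (range (vec_nth b)) = A"

text \<open>An element \<open>h = (\<Sum>j. h\<^sub>j j)\<close> of a group algebra is the finitely supported function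
  \<open>j \<mapsto> h\<^sub>j\<close>.\<close>

definition scl :: "complex \<Rightarrow> ('g \<Rightarrow>\<^sub>0 complex) \<Rightarrow> ('g \<Rightarrow>\<^sub>0 complex)" where
  "scl c h = Poly_Mapping.map ((*) c) h"

abbreviation Z_basis :: "('g \<Rightarrow>\<^sub>0 complex) ^ 'n \<Rightarrow> ('g \<Rightarrow>\<^sub>0 complex) set \<Rightarrow> bool" where
  "Z_basis \<equiv> basis_of (\<lambda>n::int. scl (of_int n))"

abbreviation Q_basis :: "('g \<Rightarrow>\<^sub>0 complex) ^ 'n \<Rightarrow> ('g \<Rightarrow>\<^sub>0 complex) set \<Rightarrow> bool" where
  "Q_basis \<equiv> basis_of (\<lambda>q::rat. scl (of_rat q))"

abbreviation integral_basis :: "complex ^ 'n \<Rightarrow> complex set \<Rightarrow> bool" where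
  "integral_basis b L \<equiv> basis_of (\<lambda>(n::int) x. of_int n * x) b (ring_of_integers L)"

definition group_algebra :: "complex set \<Rightarrow> 'g set \<Rightarrow> ('g \<Rightarrow>\<^sub>0 complex) set" where
  "group_algebra M J =
     {h. Poly_Mapping.keys h \<subseteq> J \<and> range (Poly_Mapping.lookup h) \<subseteq> M}"

text \<open>\<open>\<tau>\<close> acts on \<open>M[J]\<close> by \<open>\<Sum>j. h\<^sub>j j \<mapsto> \<Sum>j. \<tau>(h\<^sub>j) (\<tau> j \<tau>\<^sup>-\<^sup>1)\<close>.\<close>

definition galois_twist ::
    "complex set \<Rightarrow> (complex \<Rightarrow> complex) \<Rightarrow>
     ((complex \<Rightarrow> complex) \<Rightarrow>\<^sub>0 complex) \<Rightarrow> ((complex \<Rightarrow> complex) \<Rightarrow>\<^sub>0 complex)" where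
  "galois_twist E \<tau> h =
     (\<Sum>j\<in>Poly_Mapping.keys h.
        Poly_Mapping.single (\<tau> \<otimes>\<^bsub>BijGroup E\<^esub> j \<otimes>\<^bsub>BijGroup E\<^esub> inv\<^bsub>BijGroup E\<^esub> \<tau>)
          (\<tau> (Poly_Mapping.lookup h j)))"

definition fixed_algebra ::
    "complex set \<Rightarrow> complex set \<Rightarrow> (complex \<Rightarrow> complex) set \<Rightarrow> (complex \<Rightarrow> complex) set \<Rightarrow>
     ((complex \<Rightarrow> complex) \<Rightarrow>\<^sub>0 complex) set" where
  "fixed_algebra E M J G' = {h \<in> group_algebra M J. \<forall>\<tau>\<in>G'. galois_twist E \<tau> h = h}"

definition act :: "((complex \<Rightarrow> complex) \<Rightarrow>\<^sub>0 complex) \<Rightarrow> complex \<Rightarrow> complex" where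
  "act h x = (\<Sum>j\<in>Poly_Mapping.keys h. Poly_Mapping.lookup h j * j x)"

definition associated_order ::
    "((complex \<Rightarrow> complex) \<Rightarrow>\<^sub>0 complex) set \<Rightarrow> complex set \<Rightarrow>
     ((complex \<Rightarrow> complex) \<Rightarrow>\<^sub>0 complex) set" where
  "associated_order H R = {h \<in> H. act h ` R \<subseteq> R}"

text \<open>The generalised index \<open>[A : \<langle>w\<rangle>\<^sub>\<int>]\<close>: the absolute value of the determinant of the matrix
  expressing \<open>w\<close> in a \<open>\<int>\<close>-basis of \<open>A\<close>.  The value does not depend on the chosen basis.\<close>

definition gen_index :: "('g \<Rightarrow>\<^sub>0 complex) set \<Rightarrow> ('g \<Rightarrow>\<^sub>0 complex) ^ 'n \<Rightarrow> rat" where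
  "gen_index A w =
     (THE d. \<exists>(v :: ('g \<Rightarrow>\<^sub>0 complex) ^ 'n) (P :: rat ^ 'n ^ 'n).
        Z_basis v A \<and> (\<forall>i. vec_nth w i = (\<Sum>j\<in>UNIV. scl (of_rat (vec_nth (vec_nth P i) j)) (vec_nth v j))) \<and>
        d = \<bar>det P\<bar>)"

text \<open>The scalar actions used above are module structures, so the theory of \<open>span\<close> and
  \<open>dependent\<close> applies to them.\<close>

lemma lookup_scl [simp]: "Poly_Mapping.lookup (scl c h) j = c * Poly_Mapping.lookup h j"
  by (simp add: scl_def Poly_Mapping.map.rep_eq when_def)

lemma module_scl_int:
  "Modules.module (\<lambda>n::int. scl (of_int n) :: ('g \<Rightarrow>\<^sub>0 complex) \<Rightarrow> _)"
  by unfold_locales (auto intro!: poly_mapping_eqI simp: lookup_add algebra_simps)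

lemma vector_space_scl_rat:
  "Vector_Spaces.vector_space (\<lambda>q::rat. scl (of_rat q) :: ('g \<Rightarrow>\<^sub>0 complex) \<Rightarrow> _)"
  by unfold_locales
    (auto intro!: poly_mapping_eqI simp: lookup_add algebra_simps of_rat_add of_rat_mult)

lemma module_complex_int: "Modules.module (\<lambda>(n::int) (x::complex). of_int n * x)"
  by unfold_locales (auto simp: algebra_simps)

lemma vector_space_complex_rat: "Vector_Spaces.vector_space (\<lambda>(q::rat) (x::complex). of_rat q * x)"
  by unfold_locales (auto simp: algebra_simps of_rat_add of_rat_mult)

end

theory Submission
  imports Defs
begin

text \<open>With rational \<open>x\<close>, \<open>y\<close>, \<open>t\<close>, the element \<open>x w\<^sub>1 + y w\<^sub>2 + t w\<^sub>3\<close> acts on the powers of \<open>\<alpha>\<close> by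
  explicit formulas, because \<open>z = \<plusminus>(\<alpha> - \<alpha>\<^sub>2)(\<alpha>\<^sub>2 - \<alpha>\<^sub>3)(\<alpha>\<^sub>3 - \<alpha>)\<close>.  As \<open>3\<close> divides \<open>a\<close>, it preserves
  \<open>\<int>[\<alpha>]\<close> iff \<open>x + 2t\<close>, \<open>6ay\<close> and \<open>x - t \<plusminus> 9by\<close> are integers.  Eliminating \<open>x\<close> and \<open>t\<close>, \<open>y\<close>
  ranges over \<open>\<int> / 6d\<close> with \<open>d = gcd(a, 3b)\<close>, so the index is \<open>18d\<close>; here \<open>d\<close> is \<open>g\<close> or \<open>3g\<close>
  according to the valuations at 3.  The shape of the basis depends on the parity of \<open>3b / d\<close>, which
  the valuations at 2 decide.

  That \<open>W\<close> spans \<open>H\<close> needs the Galois group of \<open>Lt\<close> over \<open>L\<close>.  As \<open>\<sigma>\<close> fixes \<open>z\<close> and permutes the roots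
  cyclically, \<open>z \<in> L\<close> forces \<open>z \<in> \<rat>\<close>; otherwise \<open>Lt = L \<oplus> Lz\<close> carries the automorphism
  \<open>u + vz \<mapsto> u - vz\<close>, which swaps \<open>\<alpha>\<^sub>2\<close> and \<open>\<alpha>\<^sub>3\<close>.\<close>

section \<open>Ordered bases and the generalised index\<close>

text \<open>Passes from the sets seen by \<open>dependent\<close> and \<open>span\<close> to
  coefficients indexed by \<open>'n\<close>. The injectivity clause is absorbed by independence,
  because two equal members give a relation with coefficients 1 and -1.\<close>

lemma basis_of_iff:
  fixes smul :: "'r::comm_ring_1 \<Rightarrow> 'v::ab_group_add \<Rightarrow> 'v" and b :: "'v ^ 'n"
  assumes "Modules.module smul"
  shows "basis_of smul b A \<longleftrightarrow>
    (\<forall>c. (\<Sum>i\<in>UNIV. smul (c i) (b $ i)) = 0 \<longrightarrow> (\<forall>i. c i = 0)) \<and>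
    A = range (\<lambda>c. \<Sum>i\<in>UNIV. smul (c i) (b $ i))"
proof -
  interpret m: Modules.module smul by fact
  have inj: "inj (vec_nth b)"
    if indep: "\<forall>c. (\<Sum>i\<in>UNIV. smul (c i) (b $ i)) = 0 \<longrightarrow> (\<forall>i. c i = 0)"
  proof (rule injI, rule ccontr)
    fix i j assume eq: "b $ i = b $ j" and "i \<noteq> j"
    let ?c = "\<lambda>k. (if k = i then 1 else 0) - (if k = j then 1 else 0 :: 'r)"
    have "(\<Sum>k\<in>UNIV. smul (?c k) (b $ k)) =
        (\<Sum>k\<in>UNIV. if k = i then b $ k else 0) - (\<Sum>k\<in>UNIV. if k = j then b $ k else 0)"
      unfolding sum_subtractf [symmetric] by (rule sum.cong) (auto simp: m.scale_left_diff_distrib)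
    also have "\<dots> = 0" using eq by simp
    finally have "?c i = 0" by (rule indep [rule_format])
    then show False using \<open>i \<noteq> j\<close> by simp
  qed
  have sum_range: "(\<Sum>v\<in>range (vec_nth b). smul (u v) v) = (\<Sum>i\<in>UNIV. smul (u (b $ i)) (b $ i))"
    if inj: "inj (vec_nth b)" for u
    using sum.reindex [OF inj] by simp
  \<comment> \<open>Along an injective family, coefficients attached to indices and coefficients
    attached to vectors are the same data.\<close>
  have reparam: "\<exists>u. c = (\<lambda>i. u (b $ i))" if inj: "inj (vec_nth b)" for c :: "'n \<Rightarrow> 'r"
    using inj by (intro exI [of _ "\<lambda>v. c (inv_into UNIV (vec_nth b) v)"]) (simp add: fun_eq_iff)
  have dep: "(\<not> m.dependent (range (vec_nth b))) \<longleftrightarrow>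
    (\<forall>c. (\<Sum>i\<in>UNIV. smul (c i) (b $ i)) = 0 \<longrightarrow> (\<forall>i. c i = 0))" if inj: "inj (vec_nth b)"
  proof
    assume *: "\<not> m.dependent (range (vec_nth b))"
    show "\<forall>c. (\<Sum>i\<in>UNIV. smul (c i) (b $ i)) = 0 \<longrightarrow> (\<forall>i. c i = 0)"
    proof (intro allI impI)
      fix c i assume c: "(\<Sum>i\<in>UNIV. smul (c i) (b $ i)) = 0"
      obtain u where u: "c = (\<lambda>i. u (b $ i))" using reparam [OF inj] by blast
      show "c i = 0"
        using * c unfolding m.dependent_finite [OF finite_imageI [OF finite]] sum_range [OF inj] u
        by auto
    qed
  next
    assume *: "\<forall>c. (\<Sum>i\<in>UNIV. smul (c i) (b $ i)) = 0 \<longrightarrow> (\<forall>i. c i = 0)"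
    show "\<not> m.dependent (range (vec_nth b))"
    proof
      assume "m.dependent (range (vec_nth b))"
      then obtain u i where "u (b $ i) \<noteq> 0" "(\<Sum>i\<in>UNIV. smul (u (b $ i)) (b $ i)) = 0"
        unfolding m.dependent_finite [OF finite_imageI [OF finite]] sum_range [OF inj] by blast
      with * [rule_format, of "\<lambda>i. u (b $ i)"] show False by blast
    qed
  qed
  have span: "m.span (range (vec_nth b)) = range (\<lambda>c. \<Sum>i\<in>UNIV. smul (c i) (b $ i))"
    if inj: "inj (vec_nth b)"
  proof -
    have "m.span (range (vec_nth b)) = range (\<lambda>u. \<Sum>i\<in>UNIV. smul (u (b $ i)) (b $ i))"
      unfolding m.span_finite [OF finite_imageI [OF finite]] sum_range [OF inj] ..
    also have "\<dots> = range (\<lambda>c. \<Sum>i\<in>UNIV. smul (c i) (b $ i))"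
      proof (intro equalityI subsetI)
      fix s assume "s \<in> range (\<lambda>c. \<Sum>i\<in>UNIV. smul (c i) (b $ i))"
      then obtain c where s: "s = (\<Sum>i\<in>UNIV. smul (c i) (b $ i))" by blast
      obtain u where u: "c = (\<lambda>i. u (b $ i))" using reparam [OF inj] by blast
      show "s \<in> range (\<lambda>u. \<Sum>i\<in>UNIV. smul (u (b $ i)) (b $ i))"
        unfolding s u by (rule rangeI)
    qed auto
    finally show ?thesis .
  qed
  show ?thesis
  proof (cases "inj (vec_nth b)")
    case True
    show ?thesis unfolding basis_of_def dep [OF True] span [OF True] using True by auto
  next
    case False
    then show ?thesis unfolding basis_of_def using inj by blast
  qed
qed

lemma basis_of_vector_3:
  fixes smul :: "'r::comm_ring_1 \<Rightarrow> 'v::ab_group_add \<Rightarrow> 'v" and u v w :: 'v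
  assumes "Modules.module smul"
  shows "basis_of smul (vector [u, v, w] :: 'v ^ 3) A \<longleftrightarrow>
    (\<forall>x y t. smul x u + smul y v + smul t w = 0 \<longrightarrow> x = 0 \<and> y = 0 \<and> t = 0) \<and>
    A = {smul x u + smul y v + smul t w | x y t. True}"
proof -
  \<comment> \<open>Functions on the three-element type correspond to triples; the witness takes the
    value \<open>t\<close> at the remaining index 3.\<close>
  have all: "(\<forall>c :: 3 \<Rightarrow> 'r. P (c 1) (c 2) (c 3)) \<longleftrightarrow> (\<forall>x y t. P x y t)" for P
  proof (intro iffI allI)
    fix x y t assume "\<forall>c :: 3 \<Rightarrow> 'r. P (c 1) (c 2) (c 3)"
    from this [rule_format, of "\<lambda>i. if i = 1 then x else if i = 2 then y else t"]
    show "P x y t" by simp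
  qed auto
  have "range (\<lambda>c :: 3 \<Rightarrow> 'r. smul (c 1) u + smul (c 2) v + smul (c 3) w) =
      {smul x u + smul y v + smul t w | x y t. True}"
  proof -
    have "s \<in> range (\<lambda>c :: 3 \<Rightarrow> 'r. smul (c 1) u + smul (c 2) v + smul (c 3) w) \<longleftrightarrow>
      (\<exists>x y t. s = smul x u + smul y v + smul t w)" for s
      using all [of "\<lambda>x y t. s \<noteq> smul x u + smul y v + smul t w"] unfolding image_iff by blast
    then show ?thesis unfolding set_eq_iff mem_Collect_eq simp_thms by blast
  qed
  then show ?thesis
    using all [of "\<lambda>x y t. smul x u + smul y v + smul t w = 0 \<longrightarrow> x = 0 \<and> y = 0 \<and> t = 0"]
    unfolding basis_of_iff [OF assms] by (simp add: sum_3 forall_3)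
qed

section \<open>Clearing denominators, changes of basis and the index\<close>

lemma common_denominator:
  fixes f :: "'i::finite \<Rightarrow> rat"
  obtains N :: int and k :: "'i \<Rightarrow> int" where "N > 0" "\<And>i. of_int N * f i = of_int (k i)"
proof
  let ?N = "\<Prod>i\<in>UNIV. snd (quotient_of (f i))"
  show "?N > 0" by (intro prod_pos) (simp add: quotient_of_denom_pos')
  fix i
  let ?M = "\<Prod>i\<in>UNIV - {i}. snd (quotient_of (f i))"
  have "f i = of_int (fst (quotient_of (f i))) / of_int (snd (quotient_of (f i)))"
    by (rule quotient_of_div) simp
  then have f: "f i * of_int (snd (quotient_of (f i))) = of_int (fst (quotient_of (f i)))"
    using quotient_of_denom_pos' [of "f i"] by (simp add: field_simps)
  have "?N = snd (quotient_of (f i)) * ?M"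
    by (rule prod.remove) auto
  then have "of_int ?N * f i = of_int ?M * (f i * of_int (snd (quotient_of (f i))))"
    by (simp only: of_int_mult mult.commute mult.left_commute)
  then show "of_int ?N * f i = of_int (?M * fst (quotient_of (f i)))"
    by (simp only: of_int_mult f)
qed

lemma scl_scl: "scl c (scl d h) = scl (c * d) h"
  by (rule poly_mapping_eqI) simp

lemma scl_diff_left: "scl (c - d) h = scl c h - scl d h"
  by (rule poly_mapping_eqI) (simp add: lookup_minus algebra_simps)

lemma scl_sum: "scl c (\<Sum>i\<in>I. f i) = (\<Sum>i\<in>I. scl c (f i))"
  by (rule poly_mapping_eqI) (simp add: lookup_sum sum_distrib_left)

lemma scl_sum_left: "scl (\<Sum>i\<in>I. e i) h = (\<Sum>i\<in>I. scl (e i) h)"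
  by (rule poly_mapping_eqI) (simp add: lookup_sum sum_distrib_right)

lemma scl_one [simp]: "scl 1 h = h"
  by (rule poly_mapping_eqI) simp

lemma scl_zero [simp]: "scl 0 h = 0" "scl c 0 = 0"
  by (rule poly_mapping_eqI, simp)+

text \<open>Multiplication by a common denominator turns a rational relation into an integral one,
  which the basis property forces to be trivial.\<close>

lemma Z_basis_rat_indep:
  fixes v :: "('g \<Rightarrow>\<^sub>0 complex) ^ 'n"
  assumes "Z_basis v A" "(\<Sum>i\<in>UNIV. scl (of_rat (c i)) (v $ i)) = 0"
  shows "c i = 0"
proof -
  obtain N k where N: "N > 0" and k: "\<And>i. of_int N * c i = of_int (k i)"
    using common_denominator by blast
  have kc: "of_int (k i) = (of_int N * of_rat (c i) :: complex)" for i
    by (metis k of_rat_mult of_rat_of_int_eq)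
  have "(\<Sum>i\<in>UNIV. scl (of_int (k i)) (v $ i)) = scl (of_int N) (\<Sum>i\<in>UNIV. scl (of_rat (c i)) (v $ i))"
    by (simp add: scl_sum scl_scl kc)
  also have "\<dots> = 0" using assms(2) by simp
  finally have "k i = 0"
    using assms(1) unfolding basis_of_iff [OF module_scl_int] by blast
  then show ?thesis using N k [of i] by simp
qed

text \<open>The members of \<open>v'\<close> are integral combinations of \<open>v\<close>, with
  matrix \<open>U\<close>. Rational independence gives \<open>P = P' ** U\<close>, so the
  determinants differ by the integer factor \<open>det U\<close>.\<close>

lemma Z_basis_det_multiple:
  fixes v v' w :: "('g \<Rightarrow>\<^sub>0 complex) ^ 'n" and P P' :: "rat ^ 'n ^ 'n"
  assumes v: "Z_basis v A" and v': "Z_basis v' A"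
    and P: "\<And>i. w $ i = (\<Sum>j\<in>UNIV. scl (of_rat (P $ i $ j)) (v $ j))"
    and P': "\<And>i. w $ i = (\<Sum>j\<in>UNIV. scl (of_rat (P' $ i $ j)) (v' $ j))"
  obtains k :: int where "det P = det P' * of_int k"
proof -
  have "v' $ j \<in> A" for j
  proof -
    have "v' $ j = (\<Sum>i\<in>UNIV. scl (of_int (if i = j then 1 else 0)) (v' $ i))"
      by (subst sum.remove [of _ j]) (auto simp: scl_one)
    also have "\<dots> \<in> A" using v' unfolding basis_of_iff [OF module_scl_int] by (simp only:) (rule rangeI)
    finally show ?thesis .
  qed
  then have "\<exists>c :: 'n \<Rightarrow> int. v' $ j = (\<Sum>i\<in>UNIV. scl (of_int (c i)) (v $ i))" for j
    using v unfolding basis_of_iff [OF module_scl_int] by blast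
  then obtain U :: "'n \<Rightarrow> 'n \<Rightarrow> int"
    where U: "\<And>j. v' $ j = (\<Sum>i\<in>UNIV. scl (of_int (U j i)) (v $ i))"
    by metis
  let ?U = "\<chi> j i. rat_of_int (U j i)"
  have "P = P' ** ?U"
  proof (subst vec_eq_iff, intro allI, subst vec_eq_iff, intro allI)
    fix i k
    have "w $ i = (\<Sum>j\<in>UNIV. \<Sum>k\<in>UNIV. scl (of_rat (P' $ i $ j * of_int (U j k))) (v $ k))"
      unfolding P' U by (simp add: scl_sum scl_scl of_rat_mult)
    also have "\<dots> = (\<Sum>k\<in>UNIV. scl (of_rat ((P' ** ?U) $ i $ k)) (v $ k))"
      by (subst sum.swap) (simp add: matrix_matrix_mult_def scl_sum_left of_rat_sum)
    finally have "(\<Sum>k\<in>UNIV. scl (of_rat (P $ i $ k)) (v $ k)) =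
        (\<Sum>k\<in>UNIV. scl (of_rat ((P' ** ?U) $ i $ k)) (v $ k))"
      unfolding P .
    then have "(\<Sum>k\<in>UNIV. scl (of_rat (P $ i $ k - (P' ** ?U) $ i $ k)) (v $ k)) = 0"
      by (simp add: of_rat_diff scl_diff_left sum_subtractf del: of_rat_add)
    from Z_basis_rat_indep [OF v this] show "P $ i $ k = (P' ** ?U) $ i $ k" by simp
  qed
  then have "det P = det P' * det ?U" by (simp add: det_mul)
  moreover have "det ?U = of_int (det (\<chi> j i. U j i))"
    by (simp add: det_def)
  ultimately show ?thesis using that by metis
qed

text \<open>Evaluates the definite description from a single basis: two bases give determinants that
  are integer multiples of each other, hence of equal absolute value.\<close>

lemma gen_index_eq:
  fixes v w :: "('g \<Rightarrow>\<^sub>0 complex) ^ 'n" and P :: "rat ^ 'n ^ 'n"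
  assumes "Z_basis v A" "\<And>i. w $ i = (\<Sum>j\<in>UNIV. scl (of_rat (P $ i $ j)) (v $ j))"
  shows "gen_index A w = \<bar>det P\<bar>"
  unfolding gen_index_def
proof (rule the_equality)
  show "\<exists>(v :: ('g \<Rightarrow>\<^sub>0 complex) ^ 'n) (P' :: rat ^ 'n ^ 'n). Z_basis v A \<and> (\<forall>i. w $ i = (\<Sum>j\<in>UNIV. scl (of_rat (P' $ i $ j)) (v $ j))) \<and>
      \<bar>det P\<bar> = \<bar>det P'\<bar>"
    using assms by blast
next
  fix d assume "\<exists>(v :: ('g \<Rightarrow>\<^sub>0 complex) ^ 'n) (P :: rat ^ 'n ^ 'n). Z_basis v A \<and>
      (\<forall>i. w $ i = (\<Sum>j\<in>UNIV. scl (of_rat (P $ i $ j)) (v $ j))) \<and> d = \<bar>det P\<bar>"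
  then obtain v' and P' :: "rat ^ 'n ^ 'n" where v': "Z_basis v' A"
    and P': "\<And>i. w $ i = (\<Sum>j\<in>UNIV. scl (of_rat (P' $ i $ j)) (v' $ j))" and d: "d = \<bar>det P'\<bar>"
    by blast
  obtain k where k: "det P = det P' * of_int k"
    using Z_basis_det_multiple [OF assms(1) v' assms(2) P'] .
  obtain l where l: "det P' = det P * of_int l"
    using Z_basis_det_multiple [OF v' assms(1) P' assms(2)] .
  \<comment> \<open>If \<open>l\<close> is zero, both numbers vanish; otherwise its absolute value
    is at least 1, so multiplying \<open>x\<close> by it cannot shrink \<open>x\<close>.\<close>
  have le: "\<bar>x\<bar> \<le> \<bar>y\<bar>" if x: "x = y * of_int k" and y: "y = x * of_int l" for x y :: rat and k l
  proof (cases "l = 0")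
    case True
    then have "y = 0" using y by simp
    then show ?thesis using x by simp
  next
    case False
    then have "1 \<le> \<bar>l\<bar>" by linarith
    then have "(1::rat) \<le> \<bar>of_int l\<bar>" by (metis of_int_1_le_iff of_int_abs)
    then have "\<bar>x\<bar> * 1 \<le> \<bar>x\<bar> * \<bar>of_int l\<bar>" by (rule mult_left_mono) simp
    also have "\<dots> = \<bar>y\<bar>" by (subst y) (rule abs_mult [symmetric])
    finally show ?thesis by simp
  qed
  show "d = \<bar>det P\<bar>" unfolding d using le [OF k l] le [OF l k] by (rule order.antisym [rotated])
qed

section \<open>Valuations and greatest common divisors\<close>

lemma vp_nonzero: "n \<noteq> 0 \<Longrightarrow> vp p n = enat (multiplicity (int p) n)"
  by (simp add: vp_def)

text \<open>The exponent is the multiplicity of \<open>p\<close> in \<open>b\<close>. The value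
  \<open>a = 0\<close>, of infinite valuation, is covered because every power divides it.\<close>

lemma vp_le_imp_decomp:
  fixes p :: nat and a b :: int
  assumes p: "Factorial_Ring.prime p" and "b \<noteq> 0" "vp p b \<le> vp p a"
  obtains k a' b' where "a = int p ^ k * a'" "b = int p ^ k * b'" "\<not> int p dvd b'"
proof -
  let ?k = "multiplicity (int p) b"
  have "\<not> is_unit (int p)" using p by (metis not_prime_unit prime_nat_int_transfer)
  obtain b' where b': "b = int p ^ ?k * b'" "\<not> int p dvd b'"
    using multiplicity_decompose' [OF \<open>b \<noteq> 0\<close> \<open>\<not> is_unit (int p)\<close>] by metis
  have "int p ^ ?k dvd a"
  proof (cases "a = 0")
    case False
    then have "?k \<le> multiplicity (int p) a" using assms by (simp add: vp_nonzero)
    then show ?thesis by (rule multiplicity_dvd')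
  qed simp
  then obtain a' where "a = int p ^ ?k * a'" by (rule dvdE)
  then show ?thesis using that b' by blast
qed

lemma vp_less_imp_decomp:
  fixes p :: nat and a b :: int
  assumes p: "Factorial_Ring.prime p" and "vp p b < vp p a"
  obtains k a' b' where "a = int p ^ Suc k * a'" "b = int p ^ k * b'" "\<not> int p dvd b'"
proof -
  \<comment> \<open>A strict inequality excludes infinite valuation on its smaller side.\<close>
  have b: "b \<noteq> 0" using assms(2) by (auto simp: vp_def)
  let ?k = "multiplicity (int p) b"
  have "\<not> is_unit (int p)" using p by (metis not_prime_unit prime_nat_int_transfer)
  obtain b' where b': "b = int p ^ ?k * b'" "\<not> int p dvd b'"
    using multiplicity_decompose' [OF b \<open>\<not> is_unit (int p)\<close>] by metis
  have "int p ^ Suc ?k dvd a"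
  proof (cases "a = 0")
    case False
    then have "Suc ?k \<le> multiplicity (int p) a" using assms(2) b by (simp add: vp_nonzero Suc_le_eq)
    then show ?thesis by (rule multiplicity_dvd')
  qed simp
  then obtain a' where "a = int p ^ Suc ?k * a'" by (rule dvdE)
  then show ?thesis using that b' by blast
qed

lemma gcd_power_mult: "gcd (int p ^ k * x) (int p ^ k * y) = int p ^ k * gcd x y"
  by (simp add: gcd_mult_left abs_mult)

text \<open>Once the common power of \<open>p\<close> is removed, the cofactor of \<open>a\<close>
  is prime to \<open>p\<close>, so a further \<open>p\<close> in the other argument does not affect
  the gcd. The decomposition is applied with \<open>a\<close> and \<open>b\<close>
  exchanged.\<close>

lemma gcd_mult_prime_of_vp_le:
  fixes p :: nat and a b :: int
  assumes p: "Factorial_Ring.prime p" and "a \<noteq> 0" "vp p a \<le> vp p b"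
  shows "gcd a (int p * b) = gcd a b"
proof -
  obtain k a' b' where ab: "b = int p ^ k * b'" "a = int p ^ k * a'" and "\<not> int p dvd a'"
    using vp_le_imp_decomp [OF assms] .
  then have "coprime a' (int p)"
    using p by (metis coprime_commute prime_imp_coprime prime_nat_int_transfer)
  then have "gcd a' (int p * b') = gcd a' b'"
    by (simp add: gcd_mult_right_left_cancel)
  then show ?thesis unfolding ab mult.left_commute [of "int p" "int p ^ k"] gcd_power_mult by simp
qed

text \<open>Here \<open>a\<close> has a factor \<open>p\<close> to spare, so the additional
  \<open>p\<close> passes entirely into the gcd, whereas in \<open>gcd a b\<close> the spare factor
  meets a cofactor prime to \<open>p\<close> and is lost.\<close>

lemma gcd_mult_prime_of_vp_less:
  fixes p :: nat and a b :: int
  assumes p: "Factorial_Ring.prime p" and "vp p b < vp p a"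
  shows "gcd a (int p * b) = int p * gcd a b"
proof -
  obtain k a' b' where ab: "a = int p ^ Suc k * a'" "b = int p ^ k * b'" and "\<not> int p dvd b'"
    using vp_less_imp_decomp [OF assms] .
  then have "coprime b' (int p)"
    using p by (metis coprime_commute prime_imp_coprime prime_nat_int_transfer)
  then have "gcd (int p * a') b' = gcd a' b'"
    by (simp add: gcd_mult_left_left_cancel coprime_commute)
  moreover have "gcd a (int p * b) = int p ^ Suc k * gcd a' b'"
    unfolding ab gcd_power_mult [symmetric] by (simp only: power_Suc mult.assoc)
  moreover have "gcd a b = int p ^ k * gcd (int p * a') b'"
    unfolding ab gcd_power_mult [symmetric] by (simp only: power_Suc mult.assoc mult.left_commute)
  ultimately show ?thesis by (simp only: power_Suc mult.assoc)
qed

text \<open>The exact power of 2 in \<open>3 * b\<close> already divides the gcd, so no factor 2 is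
  left for \<open>m\<close>.\<close>

lemma odd_cofactor_of_vp_le:
  fixes a b :: int
  assumes "b \<noteq> 0" "vp 2 b \<le> vp 2 a" "3 * b = gcd a (3 * b) * m"
  shows "odd m"
proof
  assume "even m"
  obtain k a' b' where ab: "a = 2 ^ k * a'" "b = 2 ^ k * b'" and b': "odd b'"
    using vp_le_imp_decomp [OF two_is_prime_nat assms(1,2)] by auto
  have "2 ^ k dvd gcd a (3 * b)" unfolding ab by simp
  then obtain c where "gcd a (3 * b) = 2 ^ k * c" by (rule dvdE)
  then have "2 ^ k * (3 * b') = 2 ^ k * (c * m)" using assms(3) ab(2) by (simp add: mult_ac)
  then have "3 * b' = c * m" by simp
  then have "even (3 * b')" using \<open>even m\<close> by simp
  with b' show False by simp
qed

text \<open>The gcd contains only the power of 2 in \<open>a\<close>, which is smaller than that in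
  \<open>3 * b\<close>; the surplus remains in \<open>m\<close>.\<close>

lemma even_cofactor_of_vp_less:
  fixes a b :: int
  assumes "vp 2 a < vp 2 b" "3 * b = gcd a (3 * b) * m"
  shows "even m"
proof -
  obtain k a' b' where ab: "b = 2 ^ Suc k * b'" "a = 2 ^ k * a'" and a': "odd a'"
    using vp_less_imp_decomp [OF two_is_prime_nat assms(1)] by auto
  have "gcd a (3 * b) = 2 ^ k * gcd a' (2 * (3 * b'))"
    using gcd_power_mult [of 2 k a' "2 * (3 * b')"]
    unfolding ab by (simp add: mult.left_commute [of _ "2 ^ k"])
  then have "2 ^ k * (2 * (3 * b')) = 2 ^ k * (gcd a' (2 * (3 * b')) * m)"
    using assms(2) ab(1) by (simp add: mult_ac)
  then have "2 * (3 * b') = gcd a' (2 * (3 * b')) * m" by simp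
  then have "even (gcd a' (2 * (3 * b')) * m)" by (metis dvd_triv_left)
  moreover have "odd (gcd a' (2 * (3 * b')))" using a' by (meson dvd_trans gcd_dvd1)
  ultimately show ?thesis by simp
qed

section \<open>Subfields of the complex numbers and their embeddings\<close>

lemma CC_simps [simp]:
  "carrier CC = UNIV" "x \<otimes>\<^bsub>CC\<^esub> y = x * y" "x \<oplus>\<^bsub>CC\<^esub> y = x + y" "\<one>\<^bsub>CC\<^esub> = 1" "\<zero>\<^bsub>CC\<^esub> = 0"
  by (simp_all add: ring_of_type_algebra_def)

lemma CC_a_inv [simp]: "\<ominus>\<^bsub>CC\<^esub> x = - x"
proof -
  interpret ring CC by (rule ring_from_type_algebra)
  show ?thesis by (rule minus_equality) auto
qed

lemma CC_m_inv [simp]: "x \<noteq> 0 \<Longrightarrow> inv\<^bsub>CC\<^esub> x = inverse x"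
proof -
  assume "x \<noteq> 0"
  interpret cring CC by (rule cring_from_type_algebra)
  show ?thesis by (rule comm_inv_char) (use \<open>x \<noteq> 0\<close> in auto)
qed

section \<open>Closure properties in the arithmetic of the type \<open>complex\<close>\<close>

locale complex_subring =
  fixes R :: "complex set"
  assumes one [simp]: "1 \<in> R"
    and uminus [simp]: "x \<in> R \<Longrightarrow> - x \<in> R"
    and add [simp]: "x \<in> R \<Longrightarrow> y \<in> R \<Longrightarrow> x + y \<in> R"
    and mult [simp]: "x \<in> R \<Longrightarrow> y \<in> R \<Longrightarrow> x * y \<in> R"
begin

lemma diff [simp]: "x \<in> R \<Longrightarrow> y \<in> R \<Longrightarrow> x - y \<in> R"
  using add [of x "- y"] by simp

lemma zero [simp]: "0 \<in> R"
  using diff [of 1 1] by simp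

lemma power [simp]: "x \<in> R \<Longrightarrow> x ^ n \<in> R"
  by (induction n) auto

lemma of_nat [simp]: "of_nat n \<in> R"
  by (induction n) auto

lemma of_int [simp]: "of_int n \<in> R"
  by (cases n rule: int_diff_cases) simp

lemma numeral [simp]: "numeral n \<in> R"
  using of_nat [of "numeral n"] by simp

end

locale complex_subfield = complex_subring +
  assumes inverse [simp]: "x \<in> R \<Longrightarrow> inverse x \<in> R"
begin

lemma divide [simp]: "x \<in> R \<Longrightarrow> y \<in> R \<Longrightarrow> x / y \<in> R"
  by (simp add: divide_inverse)

lemma Rats_mem [simp]: "x \<in> \<rat> \<Longrightarrow> x \<in> R"
  by (elim Rats_cases') simp

end

lemma complex_subring_Ints: "complex_subring \<int>"
  by unfold_locales auto

lemma complex_subfield_Rats: "complex_subfield \<rat>"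
  by unfold_locales auto

lemma complex_subfield_Q_adjoin: "complex_subfield (Q_adjoin S)"
proof -
  have inv: "inverse x \<in> Q_adjoin S" if "x \<in> Q_adjoin S" for x
  proof (cases "x = 0")
    case False
    then show ?thesis using generate_field.m_inv [of x CC S] that by (simp add: Q_adjoin_def)
  qed (use that in simp)
  show ?thesis
    using generate_field.one [of CC S] generate_field.a_inv [of _ CC S]
      generate_field.eng_add [of _ CC S] generate_field.eng_mult [of _ CC S] inv
    by unfold_locales (auto simp: Q_adjoin_def)
qed

lemma Q_adjoin_incl: "x \<in> S \<Longrightarrow> x \<in> Q_adjoin S"
  unfolding Q_adjoin_def by (rule generate_field.incl)

lemma Q_adjoin_subset:
  assumes "complex_subfield K" "S \<subseteq> K"
  shows "Q_adjoin S \<subseteq> K"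
proof
  interpret complex_subfield K by fact
  fix x assume "x \<in> Q_adjoin S"
  then have "x \<in> generate_field CC S" by (simp add: Q_adjoin_def)
  then show "x \<in> K"
  proof induction
    case (m_inv h)
    then have "h \<noteq> 0" by simp
    then show ?case using m_inv by simp
  qed (use assms(2) in auto)
qed

lemma complex_subring_Z_adjoin: "complex_subring (Z_adjoin x)"
  using generate_ring.one [of CC "{x}"] generate_ring.a_inv [of _ CC "{x}"]
    generate_ring.eng_add [of _ CC "{x}"] generate_ring.eng_mult [of _ CC "{x}"]
  by unfold_locales (auto simp: Z_adjoin_def)

lemma Z_adjoin_incl: "x \<in> Z_adjoin x"
  unfolding Z_adjoin_def by (rule generate_ring.incl) simp

lemma Z_adjoin_subset:
  assumes "complex_subring K" "x \<in> K"
  shows "Z_adjoin x \<subseteq> K"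
proof
  interpret complex_subring K by fact
  fix y assume "y \<in> Z_adjoin x"
  then have "y \<in> generate_ring CC {x}" by (simp add: Z_adjoin_def)
  then show "y \<in> K" by induction (use assms(2) in auto)
qed

text \<open>Inverses come from the conjugate \<open>u - v * z\<close>. As \<open>z\<close> may
  itself lie in \<open>K\<close>, the norm can vanish at a nonzero element.\<close>

lemma complex_subfield_quadratic:
  assumes "complex_subfield K" "z ^ 2 \<in> K"
  shows "complex_subfield {u + v * z | u v. u \<in> K \<and> v \<in> K}" (is "complex_subfield ?E")
proof -
  interpret complex_subfield K by fact
  have I: "x \<in> ?E" if "x = u + v * z" "u \<in> K" "v \<in> K" for x u v
    using that by blast
  show ?thesis
  proof
    show "1 \<in> ?E" by (rule I [of _ 1 0]) auto
    fix x assume "x \<in> ?E"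
    then obtain u v where x: "x = u + v * z" and uv: "u \<in> K" "v \<in> K" by blast
    show "- x \<in> ?E" by (rule I [of _ "- u" "- v"]) (use uv in \<open>auto simp: x\<close>)
    show "inverse x \<in> ?E"
    proof (cases "u ^ 2 - v ^ 2 * z ^ 2 = 0")
      case False
      let ?n = "u ^ 2 - v ^ 2 * z ^ 2"
      have n: "(u + v * z) * (u - v * z) = ?n" by (simp add: algebra_simps power2_eq_square)
      then have x0: "x \<noteq> 0" using False x by auto
      have "inverse x = (u - v * z) / ?n"
        unfolding n [symmetric] x using False [folded n] by (simp add: divide_simps)
      then have "inverse x = u / ?n + (- v / ?n) * z" by (simp add: diff_divide_distrib)
      then show ?thesis by (rule I) (use uv assms(2) in auto)
    next
      \<comment> \<open>Either the element is zero, or \<open>u = v * z\<close> and the element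
        equals \<open>2 * u\<close>; it lies in \<open>K\<close> in both cases.\<close>
      case True
      then have "(u - v * z) * (u + v * z) = 0" by (simp add: algebra_simps power2_eq_square)
      then have "u = v * z \<or> x = 0" by (auto simp: x)
      then have "x \<in> K"
        using uv by (auto simp: x)
      then show ?thesis by (intro I [of _ "inverse x" 0]) auto
    qed
    fix y assume "y \<in> ?E"
    then obtain s t where y: "y = s + t * z" and st: "s \<in> K" "t \<in> K" by blast
    show "x + y \<in> ?E"
      by (rule I [of _ "u + s" "v + t"]) (use uv st in \<open>auto simp: x y algebra_simps\<close>)
    show "x * y \<in> ?E"
      by (rule I [of _ "u * s + v * t * z ^ 2" "u * t + v * s"])
        (use uv st assms(2) in \<open>auto simp: x y algebra_simps power2_eq_square\<close>)
  qed
qed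

lemma Q_adjoin_quadratic:
  assumes "z ^ 2 \<in> \<rat>"
  shows "Q_adjoin {z} = {u + v * z | u v. u \<in> \<rat> \<and> v \<in> \<rat>}" (is "_ = ?E")
proof
  interpret complex_subfield "Q_adjoin {z}" by (rule complex_subfield_Q_adjoin)
  have "0 + 1 * z \<in> ?E" using Rats_0 Rats_1 by blast
  then show "Q_adjoin {z} \<subseteq> ?E"
    by (intro Q_adjoin_subset complex_subfield_quadratic complex_subfield_Rats assms) simp
  show "?E \<subseteq> Q_adjoin {z}" using Q_adjoin_incl [of z "{z}"] by auto
qed

text \<open>The codomain is all of the complex numbers, so that the locale serves the embeddings
  occurring in \<open>normal_closure\<close> as well as the automorphisms in
  \<open>Gal\<close>.\<close>

locale complex_embedding = complex_subfield K for K +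
  fixes \<phi> :: "complex \<Rightarrow> complex"
  assumes hom_one [simp]: "\<phi> 1 = 1"
    and hom_add [simp]: "x \<in> K \<Longrightarrow> y \<in> K \<Longrightarrow> \<phi> (x + y) = \<phi> x + \<phi> y"
    and hom_mult [simp]: "x \<in> K \<Longrightarrow> y \<in> K \<Longrightarrow> \<phi> (x * y) = \<phi> x * \<phi> y"
begin

lemma hom_zero [simp]: "\<phi> 0 = 0"
  using hom_add [of 0 0] by simp

lemma hom_uminus [simp]: "x \<in> K \<Longrightarrow> \<phi> (- x) = - \<phi> x"
  using hom_add [of x "- x"] by (simp add: eq_neg_iff_add_eq_0 add.commute)

lemma hom_diff [simp]: "x \<in> K \<Longrightarrow> y \<in> K \<Longrightarrow> \<phi> (x - y) = \<phi> x - \<phi> y"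
  using hom_add [of x "- y"] by simp

lemma hom_power [simp]: "x \<in> K \<Longrightarrow> \<phi> (x ^ n) = \<phi> x ^ n"
  by (induction n) auto

lemma hom_of_nat [simp]: "\<phi> (of_nat n) = of_nat n"
  by (induction n) auto

lemma hom_of_int [simp]: "\<phi> (of_int n) = of_int n"
  by (cases n rule: int_diff_cases) simp

lemma hom_eq_0_iff: "x \<in> K \<Longrightarrow> \<phi> x = 0 \<longleftrightarrow> x = 0"
  using hom_mult [of x "inverse x"] by (cases "x = 0") auto

lemma hom_inj: "x \<in> K \<Longrightarrow> y \<in> K \<Longrightarrow> \<phi> x = \<phi> y \<Longrightarrow> x = y"
  using hom_eq_0_iff [of "x - y"] by simp

lemma hom_Rats [simp]: "x \<in> \<rat> \<Longrightarrow> \<phi> x = x"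
proof (elim Rats_cases')
  fix m n :: int
  assume n: "n > 0" and x: "x = of_int m / of_int n"
  then have "x * of_int n = of_int m" by simp
  moreover have "x \<in> K" by (simp add: x)
  ultimately have "\<phi> x * of_int n = of_int m" by (metis hom_mult hom_of_int of_int)
  then have "(\<phi> x - x) * of_int n = 0" using \<open>x * of_int n = of_int m\<close> by (simp add: left_diff_distrib)
  then show "\<phi> x = x" using n by simp
qed

end

text \<open>The target ring enters only through its operations, which covers both \<open>CC\<close>
  and \<open>CC\<close> with a smaller carrier.\<close>

lemma complex_embedding_ring_hom:
  assumes "complex_subfield K" "\<phi> \<in> ring_hom (CC\<lparr>carrier := K\<rparr>) CC'"
    and "monoid.mult CC' = (*)" "add CC' = (+)" "monoid.one CC' = 1"
  shows "complex_embedding K \<phi>"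
proof -
  interpret complex_subfield K by fact
  show ?thesis using assms(2-) by unfold_locales (auto simp: ring_hom_def)
qed

lemma complex_embedding_Gal:
  assumes "complex_subfield E" "\<tau> \<in> Gal E F"
  shows "complex_embedding E \<tau>"
proof (rule complex_embedding_ring_hom [OF assms(1)])
  show "\<tau> \<in> ring_hom (CC\<lparr>carrier := E\<rparr>) (CC\<lparr>carrier := E\<rparr>)"
    using assms(2) by (simp add: Gal_def ring_iso_def)
qed (auto simp: ring_of_type_algebra_def)

lemma Gal_Bij: "\<tau> \<in> Gal E F \<Longrightarrow> \<tau> \<in> Bij E"
  by (simp add: Gal_def ring_iso_def Bij_def)

lemma GalI:
  assumes "complex_embedding E \<tau>" "\<tau> \<in> Bij E" "\<And>x. x \<in> F \<Longrightarrow> \<tau> x = x"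
  shows "\<tau> \<in> Gal E F"
proof -
  interpret complex_embedding E \<tau> by fact
  show ?thesis
    using assms(2,3) Bij_imp_funcset [OF assms(2)]
    by (auto simp: Gal_def ring_iso_def Bij_def ring_hom_def)
qed

section \<open>The cubic field and its normal closure\<close>

text \<open>For \<alpha> this becomes \<int>[\<alpha>] when \<open>R = \<int>\<close> and the field
  L when \<open>R = \<rat>\<close>, as \<open>Z_adjoin_eq\<close> and \<open>L_eq\<close>
  show.\<close>

definition quad_span :: "complex set \<Rightarrow> complex \<Rightarrow> complex set" where
  "quad_span R x = {p + q * x + r * x ^ 2 | p q r. p \<in> R \<and> q \<in> R \<and> r \<in> R}"

lemma quad_spanI: "y = p + q * x + r * x ^ 2 \<Longrightarrow> p \<in> R \<Longrightarrow> q \<in> R \<Longrightarrow> r \<in> R \<Longrightarrow> y \<in> quad_span R x"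
  unfolding quad_span_def by blast

lemma quad_spanE:
  assumes "y \<in> quad_span R x"
  obtains p q r where "y = p + q * x + r * x ^ 2" "p \<in> R" "q \<in> R" "r \<in> R"
  using assms unfolding quad_span_def by blast

lemma complex_subring_quad_span:
  assumes "complex_subring R" "x ^ 3 = c * x + d" "c \<in> R" "d \<in> R"
  shows "complex_subring (quad_span R x)"
proof -
  interpret complex_subring R by fact
  show ?thesis
  proof
    show "1 \<in> quad_span R x" by (rule quad_spanI [of _ 1 0 _ 0]) auto
    fix u assume "u \<in> quad_span R x"
    then obtain p q r where u: "u = p + q * x + r * x ^ 2" and R: "p \<in> R" "q \<in> R" "r \<in> R"
      by (rule quad_spanE)
    show "- u \<in> quad_span R x"
      by (rule quad_spanI [of _ "- p" "- q" _ "- r"]) (use R in \<open>auto simp: u\<close>)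
    fix v assume "v \<in> quad_span R x"
    then obtain p' q' r' where v: "v = p' + q' * x + r' * x ^ 2" and R': "p' \<in> R" "q' \<in> R" "r' \<in> R"
      by (rule quad_spanE)
    show "u + v \<in> quad_span R x"
      by (rule quad_spanI [of _ "p + p'" "q + q'" _ "r + r'"])
        (use R R' in \<open>auto simp: u v algebra_simps\<close>)
    \<comment> \<open>The cubic relation replaces \<open>x ^ 3\<close> by \<open>c * x + d\<close>
      and \<open>x ^ 4\<close> by \<open>c * x ^ 2 + d * x\<close>.\<close>
    have "u * v = (p * p' + (q * r' + r * q') * d)
        + (p * q' + q * p' + (q * r' + r * q') * c + r * r' * d) * x
        + (p * r' + q * q' + r * p' + r * r' * c) * x ^ 2"
      unfolding u v using assms(2) by Groebner_Basis.algebra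
    then show "u * v \<in> quad_span R x"
      by (rule quad_spanI) (use R R' assms(3,4) in auto)
  qed
qed

text \<open>Independence of 1, \<alpha> and its square over \<rat> says that \<alpha> has degree
  three; in the theorem it is obtained from the integral basis.\<close>

locale cubic_roots =
  fixes a b :: int and \<alpha> \<alpha>2 \<alpha>3 z :: complex and \<sigma> :: "complex \<Rightarrow> complex" and L Lt :: "complex set"
  assumes L_def: "L = Q_adjoin {\<alpha>}"
    and Lt_def: "Lt = normal_closure L"
    and roots: "[:of_int b, - of_int a, 0, 1:] = [:-\<alpha>, 1:] * [:-\<alpha>2, 1:] * [:-\<alpha>3, 1:]"
    and indep: "\<And>p q r. p \<in> \<rat> \<Longrightarrow> q \<in> \<rat> \<Longrightarrow> r \<in> \<rat> \<Longrightarrow> p + q * \<alpha> + r * \<alpha> ^ 2 = 0 \<Longrightarrow>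
          p = 0 \<and> q = 0 \<and> r = 0"
    and z: "z ^ 2 = of_int (4 * a ^ 3 - 27 * b ^ 2)"
    and \<sigma>: "\<sigma> \<in> Gal Lt \<rat>" and \<sigma>_\<alpha> [simp]: "\<sigma> \<alpha> = \<alpha>2"
    and \<sigma>_\<alpha>2 [simp]: "\<sigma> \<alpha>2 = \<alpha>3" and \<sigma>_\<alpha>3 [simp]: "\<sigma> \<alpha>3 = \<alpha>"
begin

section \<open>Relations between the roots and the discriminant\<close>

lemma \<alpha>3_eq: "\<alpha>3 = - \<alpha> - \<alpha>2"
  and a_eq: "of_int a = - (\<alpha> * \<alpha>2 + \<alpha> * \<alpha>3 + \<alpha>2 * \<alpha>3)"
  and b_eq: "of_int b = - (\<alpha> * \<alpha>2 * \<alpha>3)"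
proof -
  have "of_int b = - (\<alpha> * \<alpha>2 * \<alpha>3)" "- of_int a = \<alpha> * \<alpha>2 + \<alpha> * \<alpha>3 + \<alpha>2 * \<alpha>3" "0 = - \<alpha> - \<alpha>2 - \<alpha>3"
    using arg_cong [OF roots, of "\<lambda>p. Polynomial.coeff p 0"] arg_cong [OF roots, of "\<lambda>p. Polynomial.coeff p 1"]
      arg_cong [OF roots, of "\<lambda>p. Polynomial.coeff p 2"]
    by (simp_all add: algebra_simps numeral_2_eq_2)
  then show "\<alpha>3 = - \<alpha> - \<alpha>2" "of_int a = - (\<alpha> * \<alpha>2 + \<alpha> * \<alpha>3 + \<alpha>2 * \<alpha>3)"
    "of_int b = - (\<alpha> * \<alpha>2 * \<alpha>3)"
    by (simp_all add: algebra_simps minus_equation_iff [of "of_int a"])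
qed

lemma root_iff: "x ^ 3 = of_int a * x + of_int (- b) \<longleftrightarrow> x = \<alpha> \<or> x = \<alpha>2 \<or> x = \<alpha>3"
proof -
  have "x ^ 3 - (of_int a * x + of_int (- b)) = (x - \<alpha>) * (x - \<alpha>2) * (x - \<alpha>3)"
    unfolding of_int_minus a_eq b_eq \<alpha>3_eq by Groebner_Basis.algebra
  then have "x ^ 3 - (of_int a * x + of_int (- b)) = 0 \<longleftrightarrow> x = \<alpha> \<or> x = \<alpha>2 \<or> x = \<alpha>3"
    by (simp only: mult_eq_0_iff right_minus_eq disj_assoc)
  then show ?thesis by (simp only: right_minus_eq)
qed

text \<open>If two roots coincided, \<sigma> would make all three equal; their sum is zero, so
  \<alpha> would vanish.\<close>

lemma distinct_roots: "\<alpha> \<noteq> \<alpha>2" "\<alpha> \<noteq> \<alpha>3" "\<alpha>2 \<noteq> \<alpha>3"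
proof -
  have "\<alpha> \<noteq> 0" using indep [of 0 1 0] by auto
  then have "\<not> (\<alpha> = \<alpha>2 \<and> \<alpha> = \<alpha>3)" using \<alpha>3_eq by (auto simp: algebra_simps eq_neg_iff_add_eq_0)
  then show "\<alpha> \<noteq> \<alpha>2" "\<alpha> \<noteq> \<alpha>3" "\<alpha>2 \<noteq> \<alpha>3" using \<sigma>_\<alpha> \<sigma>_\<alpha>2 \<sigma>_\<alpha>3 by metis+
qed

lemma b_nonzero: "b \<noteq> 0"
proof
  assume "b = 0"
  then have "\<alpha> * (\<alpha> ^ 2 - of_int a) = 0" using root_iff [of \<alpha>] by (simp add: algebra_simps power3_eq_cube power2_eq_square)
  moreover have "\<alpha> \<noteq> 0" using indep [of 0 1 0] by auto
  ultimately have "- of_int a + 0 * \<alpha> + 1 * \<alpha> ^ 2 = 0" by simp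
  from indep [OF _ _ _ this] show False by simp
qed

text \<open>The square root of the discriminant given by the ordering of the roots. Only the square
  of \<open>z\<close> is prescribed, so \<open>z\<close> is known up to sign.\<close>

definition \<delta> :: complex where
  "\<delta> = (\<alpha> - \<alpha>2) * (\<alpha>2 - \<alpha>3) * (\<alpha>3 - \<alpha>)"

lemma z_cases: "z = \<delta> \<or> z = - \<delta>"
proof -
  have "z ^ 2 = \<delta> ^ 2"
    unfolding \<delta>_def unfolding z of_int_diff of_int_mult of_int_power of_int_numeral a_eq b_eq \<alpha>3_eq by Groebner_Basis.algebra
  then show ?thesis by (simp add: power2_eq_iff)
qed

lemma z_nonzero: "z \<noteq> 0"
  using z_cases distinct_roots by (auto simp: \<delta>_def)

sublocale L: complex_subfield L
  unfolding L_def by (rule complex_subfield_Q_adjoin)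

sublocale Lt: complex_subfield Lt
  unfolding Lt_def normal_closure_def by (rule complex_subfield_Q_adjoin)

lemma L_subset_Lt: "L \<subseteq> Lt"
proof
  fix x assume "x \<in> L"
  have "(\<lambda>x. x) \<in> ring_hom (CC\<lparr>carrier := L\<rparr>) CC"
    by (auto simp: ring_hom_def ring_of_type_algebra_def)
  with \<open>x \<in> L\<close> show "x \<in> Lt"
    unfolding Lt_def normal_closure_def by (intro Q_adjoin_incl) blast
qed

sublocale \<sigma>: complex_embedding Lt \<sigma>
  by (rule complex_embedding_Gal [OF Lt.complex_subfield_axioms \<sigma>])

lemma \<sigma>_Bij: "\<sigma> \<in> Bij Lt"
  by (rule Gal_Bij [OF \<sigma>])

lemma \<sigma>_mem [simp]: "x \<in> Lt \<Longrightarrow> \<sigma> x \<in> Lt"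
  using Bij_imp_funcset [OF \<sigma>_Bij] by auto

lemma \<alpha>_L [simp]: "\<alpha> \<in> L"
  unfolding L_def by (rule Q_adjoin_incl) simp

lemma roots_Lt [simp]: "\<alpha> \<in> Lt" "\<alpha>2 \<in> Lt" "\<alpha>3 \<in> Lt"
proof -
  show "\<alpha> \<in> Lt" using \<alpha>_L L_subset_Lt by (rule subsetD [rotated])
  then show "\<alpha>2 \<in> Lt" using \<sigma>_mem [of \<alpha>] by simp
  then show "\<alpha>3 \<in> Lt" using \<sigma>_mem [of \<alpha>2] by simp
qed

lemma z_Lt [simp]: "z \<in> Lt"
  using z_cases by (auto simp: \<delta>_def)

lemma \<sigma>_z [simp]: "\<sigma> z = z"
  using z_cases by (auto simp: \<delta>_def)

text \<open>A fixed element is a polynomial of degree at most two in \<alpha> that takes the same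
  value at three distinct roots, hence it is constant.\<close>

lemma \<sigma>_fixed_imp_Rats:
  assumes "x \<in> quad_span \<rat> \<alpha>" "\<sigma> x = x"
  shows "x \<in> \<rat>"
proof -
  obtain p q r where x: "x = p + q * \<alpha> + r * \<alpha> ^ 2" and pqr: "p \<in> \<rat>" "q \<in> \<rat>" "r \<in> \<rat>"
    using assms(1) by (rule quad_spanE)
  have 2: "x = p + q * \<alpha>2 + r * \<alpha>2 ^ 2" using assms(2) pqr by (simp add: x)
  have "\<sigma> (p + q * \<alpha>2 + r * \<alpha>2 ^ 2) = x" using assms(2) 2 by simp
  then have 3: "x = p + q * \<alpha>3 + r * \<alpha>3 ^ 2" using pqr by simp
  have "(\<alpha> - \<alpha>2) * (q - r * \<alpha>3) = 0" using x 2 unfolding \<alpha>3_eq by Groebner_Basis.algebra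
  moreover have "(\<alpha> - \<alpha>3) * (q - r * \<alpha>2) = 0" using x 3 unfolding \<alpha>3_eq by Groebner_Basis.algebra
  ultimately have "q = r * \<alpha>3" "q = r * \<alpha>2" using distinct_roots by auto
  then have "r = 0" "q = 0" using distinct_roots by auto
  then show ?thesis using x pqr by simp
qed

section \<open>Coordinates on the cubic field, its order \<int>[\<alpha>] and its normal
  closure\<close>

lemma \<alpha>_cubed: "\<alpha> ^ 3 = of_int a * \<alpha> + of_int (- b)"
  using root_iff by blast

lemma quad_span_Ints: "complex_subring (quad_span \<int> \<alpha>)"
  by (rule complex_subring_quad_span [OF complex_subring_Ints \<alpha>_cubed]) auto

sublocale quad: complex_subring "quad_span \<rat> \<alpha>"
  by (rule complex_subring_quad_span [OF complex_subfield.axioms(1) [OF complex_subfield_Rats] \<alpha>_cubed]) auto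

lemma \<alpha>_quad_span: "complex_subring R \<Longrightarrow> \<alpha> \<in> quad_span R \<alpha>"
  by (rule quad_spanI [of _ 0 1 _ 0])
    (auto simp: complex_subring.one complex_subring.zero)

lemma quad_span_subset_Lt: "quad_span \<rat> \<alpha> \<subseteq> Lt"
  by (auto elim!: quad_spanE)

text \<open>The inverse of \<open>u\<close> is the product of its conjugates divided by its norm; both lie in the
  span because that product is symmetric in the two other roots.\<close>

lemma quad_span_inverse:
  assumes "u \<in> quad_span \<rat> \<alpha>"
  shows "inverse u \<in> quad_span \<rat> \<alpha>"
proof (cases "u = 0")
  case False
  obtain p q r where u: "u = p + q * \<alpha> + r * \<alpha> ^ 2" and pqr: "p \<in> \<rat>" "q \<in> \<rat>" "r \<in> \<rat>"
    using assms by (rule quad_spanE)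
  have Q: "x \<in> quad_span \<rat> \<alpha>" if "x \<in> \<rat>" for x
    by (rule quad_spanI [of _ x 0 _ 0]) (use that in auto)
  have \<alpha>: "\<alpha> \<in> quad_span \<rat> \<alpha>"
    by (rule \<alpha>_quad_span [OF complex_subfield.axioms(1) [OF complex_subfield_Rats]])
  have uLt: "u \<in> Lt" using quad_span_subset_Lt assms by blast
  let ?v = "\<sigma> u * \<sigma> (\<sigma> u)"
  have \<sigma>u: "\<sigma> u = p + q * \<alpha>2 + r * \<alpha>2 ^ 2" using pqr by (simp add: u)
  have \<sigma>\<sigma>u: "\<sigma> (\<sigma> u) = p + q * \<alpha>3 + r * \<alpha>3 ^ 2" using pqr by (simp add: \<sigma>u)
  \<comment> \<open>The other two roots enter symmetrically and are eliminated by
    \<open>\<alpha>2 + \<alpha>3 = - \<alpha>\<close> and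
    \<open>\<alpha>2 * \<alpha>3 = \<alpha> ^ 2 - a\<close>.\<close>
  have "?v = p ^ 2 - p * q * \<alpha> + q ^ 2 * (\<alpha> ^ 2 - of_int a) + p * r * (2 * of_int a - \<alpha> ^ 2)
      - q * r * (\<alpha> ^ 2 - of_int a) * \<alpha> + r ^ 2 * (\<alpha> ^ 2 - of_int a) ^ 2"
    unfolding \<sigma>\<sigma>u unfolding \<sigma>u a_eq \<alpha>3_eq by Groebner_Basis.algebra
  also have "\<dots> \<in> quad_span \<rat> \<alpha>"
    by (intro quad.add quad.diff quad.mult quad.power quad.of_int quad.numeral
        Q [OF pqr(1)] Q [OF pqr(2)] Q [OF pqr(3)] \<alpha>)
  finally have v: "?v \<in> quad_span \<rat> \<alpha>" .
  have "\<sigma> u \<noteq> 0" "\<sigma> (\<sigma> u) \<noteq> 0" using False uLt by (simp_all add: \<sigma>.hom_eq_0_iff)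
  then have uv: "u * ?v \<noteq> 0" using False by simp
  \<comment> \<open>As \<sigma> permutes the three conjugates cyclically, it fixes the norm, which
    is therefore rational.\<close>
  have "\<sigma> (\<sigma> (\<sigma> u)) = u" using pqr by (simp add: u)
  then have "\<sigma> (u * ?v) = u * ?v" using uLt by (simp add: mult_ac)
  with quad.mult [OF assms v] have "u * ?v \<in> \<rat>" by (rule \<sigma>_fixed_imp_Rats)
  then have "inverse (u * ?v) \<in> \<rat>" by (rule Rats_inverse)
  then have "inverse (u * ?v) * ?v \<in> quad_span \<rat> \<alpha>" by (intro quad.mult v Q)
  moreover have "inverse (u * v) * v = inverse u" if "v \<noteq> 0" for v
    using that by simp
  with uv have "inverse (u * ?v) * ?v = inverse u" by (metis mult_zero_right)
  ultimately show ?thesis by (simp only:)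
qed simp

lemma L_eq: "L = quad_span \<rat> \<alpha>"
proof
  have "complex_subfield (quad_span \<rat> \<alpha>)"
    using quad_span_inverse by unfold_locales
  then show "L \<subseteq> quad_span \<rat> \<alpha>"
    unfolding L_def
    by (rule Q_adjoin_subset) (use \<alpha>_quad_span [OF complex_subfield.axioms(1) [OF complex_subfield_Rats]] in auto)
  show "quad_span \<rat> \<alpha> \<subseteq> L" by (auto elim!: quad_spanE)
qed

lemma Z_adjoin_eq: "Z_adjoin \<alpha> = quad_span \<int> \<alpha>"
proof
  interpret complex_subring "Z_adjoin \<alpha>" by (rule complex_subring_Z_adjoin)
  show "Z_adjoin \<alpha> \<subseteq> quad_span \<int> \<alpha>"
    by (intro Z_adjoin_subset quad_span_Ints \<alpha>_quad_span complex_subring_Ints)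
  show "quad_span \<int> \<alpha> \<subseteq> Z_adjoin \<alpha>"
    using Z_adjoin_incl [of \<alpha>] by (auto elim!: quad_spanE Ints_cases)
qed

lemma z_square_Rats: "z ^ 2 \<in> \<rat>"
  by (simp only: z Rats_of_int)

lemma z_L_imp_Rats: "z \<in> L \<Longrightarrow> z \<in> \<rat>"
  unfolding L_eq by (rule \<sigma>_fixed_imp_Rats) simp_all

text \<open>The field L + Lz contains all three roots, and an embedding of L sends \<alpha> to one
  of them, so every conjugate field lies in L + Lz. The sum is not claimed to be direct.\<close>

lemma Lt_eq: "Lt = {u + v * z | u v. u \<in> L \<and> v \<in> L}" (is "_ = ?E")
proof
  have z2: "z ^ 2 \<in> L" using z_square_Rats by (rule L.Rats_mem)
  interpret E: complex_subfield ?E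
    by (rule complex_subfield_quadratic [OF L.complex_subfield_axioms z2])
  have LE: "x \<in> ?E" if "x \<in> L" for x
    unfolding mem_Collect_eq using that L.zero by (intro exI [of _ x] exI [of _ 0]) simp
  have zE: "z \<in> ?E"
    unfolding mem_Collect_eq using L.zero L.one by (intro exI [of _ 0] exI [of _ 1]) simp
  have "\<delta> = z \<or> \<delta> = - z" using z_cases by auto
  then have "\<delta> \<in> ?E" using zE E.uminus [OF zE] by (elim disjE) (simp_all only:)
  \<comment> \<open>This is minus the derivative of the cubic at \<alpha>. Dividing \<delta> by it
    gives \<open>\<alpha>2 - \<alpha>3\<close>, and the sum \<open>\<alpha>2 + \<alpha>3\<close> is
    \<open>- \<alpha>\<close>, so both roots are recovered.\<close>
  have f': "(\<alpha> - \<alpha>2) * (\<alpha>3 - \<alpha>) = of_int a - 3 * \<alpha> ^ 2"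
    unfolding a_eq \<alpha>3_eq by Groebner_Basis.algebra
  have diff: "\<delta> / ((\<alpha> - \<alpha>2) * (\<alpha>3 - \<alpha>)) = \<alpha>2 - \<alpha>3"
    using distinct_roots by (simp add: \<delta>_def)
  have "\<alpha>2 = (- \<alpha> + \<delta> / ((\<alpha> - \<alpha>2) * (\<alpha>3 - \<alpha>))) / 2"
    unfolding diff by (simp add: \<alpha>3_eq)
  also have "\<dots> \<in> ?E"
    unfolding f' by (intro E.divide E.add E.uminus LE \<open>\<delta> \<in> ?E\<close>) auto
  finally have 2: "\<alpha>2 \<in> ?E" .
  have 3: "\<alpha>3 \<in> ?E"
    unfolding \<alpha>3_eq by (intro E.diff E.uminus LE [OF \<alpha>_L] 2)
  have "\<phi> x \<in> ?E" if \<phi>: "\<phi> \<in> ring_hom (CC\<lparr>carrier := L\<rparr>) CC" and x: "x \<in> L" for \<phi> x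
  proof -
    interpret \<phi>: complex_embedding L \<phi>
      by (rule complex_embedding_ring_hom [OF L.complex_subfield_axioms \<phi>])
        (auto simp: ring_of_type_algebra_def)
    have "\<phi> (\<alpha> ^ 3) = \<phi> (of_int a * \<alpha> + of_int (- b))" by (simp only: \<alpha>_cubed)
    then have "\<phi> \<alpha> ^ 3 = of_int a * \<phi> \<alpha> + of_int (- b)" by (simp del: of_int_minus)
    then have "\<phi> \<alpha> = \<alpha> \<or> \<phi> \<alpha> = \<alpha>2 \<or> \<phi> \<alpha> = \<alpha>3" by (simp only: root_iff)
    then have E: "\<phi> \<alpha> \<in> ?E" using LE [OF \<alpha>_L] 2 3 by (elim disjE) (simp_all only:)
    obtain p q r where "x = p + q * \<alpha> + r * \<alpha> ^ 2" and pqr: "p \<in> \<rat>" "q \<in> \<rat>" "r \<in> \<rat>"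
      using x unfolding L_eq by (rule quad_spanE)
    then have "\<phi> x = p + q * \<phi> \<alpha> + r * \<phi> \<alpha> ^ 2" by simp
    also have "\<dots> \<in> ?E"
      by (intro E.add E.mult E.power E pqr [THEN E.Rats_mem])
    finally show ?thesis .
  qed
  then show "Lt \<subseteq> ?E"
    unfolding Lt_def normal_closure_def
    by (intro Q_adjoin_subset E.complex_subfield_axioms) blast
  show "?E \<subseteq> Lt" using L_subset_Lt by (auto simp: subset_iff)
qed

end

section \<open>The Hopf algebra\<close>

context cubic_roots
begin

section \<open>Automorphisms of the normal closure and the cyclic group J\<close>

abbreviation "B \<equiv> BijGroup Lt"
abbreviation "\<iota> \<equiv> \<one>\<^bsub>B\<^esub>"
abbreviation "\<sigma>\<sigma> \<equiv> \<sigma> [^]\<^bsub>B\<^esub> (2::nat)"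

sublocale B: group B
  by (rule group_BijGroup)

lemma carrier_B [simp]: "carrier B = Bij Lt"
  by (simp add: BijGroup_def)

lemma B_mult_apply [simp]: "f \<in> Bij Lt \<Longrightarrow> g \<in> Bij Lt \<Longrightarrow> x \<in> Lt \<Longrightarrow> (f \<otimes>\<^bsub>B\<^esub> g) x = f (g x)"
  by (simp add: BijGroup_def compose_def)

lemma \<iota>_apply [simp]: "x \<in> Lt \<Longrightarrow> \<iota> x = x"
  by (simp add: BijGroup_def)

lemma \<iota>_Bij [simp]: "\<iota> \<in> Bij Lt"
  using B.one_closed by simp

lemma B_mult_Bij [simp]: "f \<in> Bij Lt \<Longrightarrow> g \<in> Bij Lt \<Longrightarrow> f \<otimes>\<^bsub>B\<^esub> g \<in> Bij Lt"
  using B.m_closed by simp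

lemma Bij_eqI:
  assumes "f \<in> Bij Lt" "g \<in> Bij Lt" "\<And>x. x \<in> Lt \<Longrightarrow> f x = g x"
  shows "f = g"
  by (rule extensionalityI [of f Lt g]) (use assms Bij_imp_extensional in auto)

lemma embedding_mult:
  assumes "complex_embedding Lt f" "complex_embedding Lt g" "f \<in> Bij Lt" "g \<in> Bij Lt"
  shows "complex_embedding Lt (f \<otimes>\<^bsub>B\<^esub> g)"
proof -
  interpret f: complex_embedding Lt f by fact
  interpret g: complex_embedding Lt g by fact
  have "g x \<in> Lt" if "x \<in> Lt" for x
    using Bij_imp_funcset [OF assms(4)] that by auto
  then show ?thesis using assms(3,4) by unfold_locales auto
qed

lemma embedding_\<iota>: "complex_embedding Lt \<iota>"
  by unfold_locales auto

lemma embedding_z: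
  assumes "complex_embedding Lt f"
  shows "z = \<delta> \<Longrightarrow> f z = (f \<alpha> - f \<alpha>2) * (f \<alpha>2 - f \<alpha>3) * (f \<alpha>3 - f \<alpha>)"
    and "z = - \<delta> \<Longrightarrow> f z = - ((f \<alpha> - f \<alpha>2) * (f \<alpha>2 - f \<alpha>3) * (f \<alpha>3 - f \<alpha>))"
proof -
  interpret f: complex_embedding Lt f by fact
  show "z = \<delta> \<Longrightarrow> f z = (f \<alpha> - f \<alpha>2) * (f \<alpha>2 - f \<alpha>3) * (f \<alpha>3 - f \<alpha>)"
    and "z = - \<delta> \<Longrightarrow> f z = - ((f \<alpha> - f \<alpha>2) * (f \<alpha>2 - f \<alpha>3) * (f \<alpha>3 - f \<alpha>))"
    by (simp_all add: \<delta>_def)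
qed

lemma embedding_\<alpha>3:
  assumes "complex_embedding Lt f"
  shows "f \<alpha>3 = - f \<alpha> - f \<alpha>2"
proof -
  interpret f: complex_embedding Lt f by fact
  have "f \<alpha>3 = f (- \<alpha> - \<alpha>2)" by (simp only: \<alpha>3_eq)
  then show ?thesis by simp
qed

text \<open>Two values determine everything: the third root is minus the sum of the others,
  \<open>z\<close> is a polynomial in the roots, and L is spanned by powers of \<alpha>. Identities
  in the group can thus be checked on \<alpha> and \<alpha>2.\<close>

lemma embedding_eqI:
  assumes f: "complex_embedding Lt f" "f \<in> Bij Lt" and g: "complex_embedding Lt g" "g \<in> Bij Lt"
    and eq: "f \<alpha> = g \<alpha>" "f \<alpha>2 = g \<alpha>2"
  shows "f = g"
proof (rule Bij_eqI [OF f(2) g(2)])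
  interpret f: complex_embedding Lt f by (rule f)
  interpret g: complex_embedding Lt g by (rule g)
  fix x assume "x \<in> Lt"
  then obtain u v where x: "x = u + v * z" and uv: "u \<in> L" "v \<in> L"
    unfolding Lt_eq by blast
  have eqL: "f y = g y" if y: "y \<in> L" for y
  proof -
    obtain p q r where "y = p + q * \<alpha> + r * \<alpha> ^ 2" "p \<in> \<rat>" "q \<in> \<rat>" "r \<in> \<rat>"
      using y unfolding L_eq by (rule quad_spanE)
    then show ?thesis using eq by simp
  qed
  have "f \<alpha>3 = g \<alpha>3" using eq by (simp only: embedding_\<alpha>3 [OF f(1)] embedding_\<alpha>3 [OF g(1)])
  then have "f z = g z"
    using z_cases embedding_z [OF f(1)] embedding_z [OF g(1)] eq by (elim disjE) simp_all
  moreover have "u \<in> Lt" "v \<in> Lt" using uv L_subset_Lt by auto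
  ultimately show "f x = g x" using uv by (simp add: x eqL)
qed

lemma \<sigma>\<sigma>_eq: "\<sigma>\<sigma> = \<sigma> \<otimes>\<^bsub>B\<^esub> \<sigma>"
  using \<sigma>_Bij by (simp add: numeral_2_eq_2)

lemma \<sigma>\<sigma>_Bij [simp]: "\<sigma>\<sigma> \<in> Bij Lt"
  unfolding \<sigma>\<sigma>_eq using \<sigma>_Bij by simp

lemma \<sigma>\<sigma>_apply [simp]: "x \<in> Lt \<Longrightarrow> \<sigma>\<sigma> x = \<sigma> (\<sigma> x)"
  unfolding \<sigma>\<sigma>_eq using \<sigma>_Bij by simp

lemma embedding_\<sigma>\<sigma>: "complex_embedding Lt \<sigma>\<sigma>"
  unfolding \<sigma>\<sigma>_eq by (intro embedding_mult \<sigma>.complex_embedding_axioms \<sigma>_Bij)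

lemma \<sigma>_cubed: "\<sigma> \<otimes>\<^bsub>B\<^esub> \<sigma>\<sigma> = \<iota>" "\<sigma>\<sigma> \<otimes>\<^bsub>B\<^esub> \<sigma> = \<iota>"
  by (intro embedding_eqI embedding_mult \<sigma>.complex_embedding_axioms embedding_\<sigma>\<sigma> embedding_\<iota>
      \<sigma>_Bij \<sigma>\<sigma>_Bij B_mult_Bij \<iota>_Bij; simp add: \<sigma>_Bij)+

lemma \<sigma>\<sigma>_\<sigma>\<sigma>: "\<sigma>\<sigma> \<otimes>\<^bsub>B\<^esub> \<sigma>\<sigma> = \<sigma>"
  by (intro embedding_eqI embedding_mult \<sigma>.complex_embedding_axioms embedding_\<sigma>\<sigma>
      \<sigma>_Bij \<sigma>\<sigma>_Bij B_mult_Bij; simp add: \<sigma>_Bij)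

lemma distinct_powers: "\<iota> \<noteq> \<sigma>" "\<iota> \<noteq> \<sigma>\<sigma>" "\<sigma> \<noteq> \<sigma>\<sigma>" "\<sigma> \<noteq> \<iota>" "\<sigma>\<sigma> \<noteq> \<iota>" "\<sigma>\<sigma> \<noteq> \<sigma>"
proof -
  have "\<iota> \<alpha> = \<alpha>" "\<sigma>\<sigma> \<alpha> = \<alpha>3" by simp_all
  then show "\<iota> \<noteq> \<sigma>" "\<iota> \<noteq> \<sigma>\<sigma>" "\<sigma> \<noteq> \<sigma>\<sigma>" "\<sigma> \<noteq> \<iota>" "\<sigma>\<sigma> \<noteq> \<iota>" "\<sigma>\<sigma> \<noteq> \<sigma>"
    using distinct_roots \<sigma>_\<alpha> by metis+
qed

lemma generate_\<sigma>: "generate B {\<sigma>} = {\<iota>, \<sigma>, \<sigma>\<sigma>}"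
proof
  have "inv\<^bsub>B\<^esub> \<sigma> = \<sigma>\<sigma>"
    by (rule B.inv_equality) (simp_all add: \<sigma>_cubed \<sigma>_Bij)
  show "generate B {\<sigma>} \<subseteq> {\<iota>, \<sigma>, \<sigma>\<sigma>}"
  proof
    fix h assume "h \<in> generate B {\<sigma>}"
    then show "h \<in> {\<iota>, \<sigma>, \<sigma>\<sigma>}"
    proof induction
      case (inv h)
      then show ?case using \<open>inv\<^bsub>B\<^esub> \<sigma> = \<sigma>\<sigma>\<close> by simp
    next
      case (eng h h')
      have "\<iota> \<otimes>\<^bsub>B\<^esub> x = x" "x \<otimes>\<^bsub>B\<^esub> \<iota> = x" if "x \<in> {\<iota>, \<sigma>, \<sigma>\<sigma>}" for x
        using that \<sigma>_Bij by auto
      then show ?case using eng.IH \<sigma>_cubed \<sigma>\<sigma>_\<sigma>\<sigma> \<sigma>\<sigma>_eq [symmetric] by auto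
    qed simp_all
  qed
  have \<sigma>_gen: "\<sigma> \<in> generate B {\<sigma>}" by (rule generate.incl) simp
  have "\<sigma>\<sigma> \<in> generate B {\<sigma>}" unfolding \<sigma>\<sigma>_eq by (intro generate.eng \<sigma>_gen)
  then show "{\<iota>, \<sigma>, \<sigma>\<sigma>} \<subseteq> generate B {\<sigma>}" using \<sigma>_gen generate.one by auto
qed

section \<open>Elements of the group algebra of J as triples of coefficients\<close>

definition tri :: "complex \<Rightarrow> complex \<Rightarrow> complex \<Rightarrow> ((complex \<Rightarrow> complex) \<Rightarrow>\<^sub>0 complex)" where
  "tri x y t = Poly_Mapping.single \<iota> x + Poly_Mapping.single \<sigma> y + Poly_Mapping.single \<sigma>\<sigma> t"

lemma lookup_tri: "Poly_Mapping.lookup (tri x y t) j =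
    (if j = \<iota> then x else if j = \<sigma> then y else if j = \<sigma>\<sigma> then t else 0)"
  using distinct_powers by (auto simp: tri_def lookup_add lookup_single when_def)

lemma lookup_tri_simps [simp]:
  "Poly_Mapping.lookup (tri x y t) \<iota> = x" "Poly_Mapping.lookup (tri x y t) \<sigma> = y"
  "Poly_Mapping.lookup (tri x y t) \<sigma>\<sigma> = t"
  using distinct_powers by (simp_all add: lookup_tri)

lemma tri_eq_iff: "tri x y t = tri x' y' t' \<longleftrightarrow> x = x' \<and> y = y' \<and> t = t'"
  using lookup_tri_simps by metis

lemma keys_tri: "Poly_Mapping.keys (tri x y t) \<subseteq> {\<iota>, \<sigma>, \<sigma>\<sigma>}"
  by (auto simp: in_keys_iff lookup_tri split: if_splits)

lemma tri_add: "tri x y t + tri x' y' t' = tri (x + x') (y + y') (t + t')"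
  by (rule poly_mapping_eqI) (simp add: lookup_add lookup_tri)

lemma tri_diff: "tri x y t - tri x' y' t' = tri (x - x') (y - y') (t - t')"
  by (rule poly_mapping_eqI) (simp add: lookup_minus lookup_tri)

lemma tri_scl: "scl c (tri x y t) = tri (c * x) (c * y) (c * t)"
  by (rule poly_mapping_eqI) (simp add: lookup_tri)

lemma tri_zero: "tri 0 0 0 = 0"
  by (simp add: tri_def)

lemma group_algebra_eq:
  assumes "0 \<in> M"
  shows "group_algebra M {\<iota>, \<sigma>, \<sigma>\<sigma>} = {tri x y t | x y t. x \<in> M \<and> y \<in> M \<and> t \<in> M}"
proof (intro equalityI subsetI)
  fix h assume h: "h \<in> group_algebra M {\<iota>, \<sigma>, \<sigma>\<sigma>}"
  let ?l = "Poly_Mapping.lookup h"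
  have "?l j = 0" if "j \<notin> {\<iota>, \<sigma>, \<sigma>\<sigma>}" for j
    using h that by (auto simp: group_algebra_def in_keys_iff)
  then have "h = tri (?l \<iota>) (?l \<sigma>) (?l \<sigma>\<sigma>)"
    by (intro poly_mapping_eqI) (auto simp: lookup_tri)
  moreover have "?l j \<in> M" for j using h by (auto simp: group_algebra_def)
  ultimately show "h \<in> {tri x y t | x y t. x \<in> M \<and> y \<in> M \<and> t \<in> M}" by blast
next
  fix h assume "h \<in> {tri x y t | x y t. x \<in> M \<and> y \<in> M \<and> t \<in> M}"
  then obtain x y t where "h = tri x y t" "x \<in> M" "y \<in> M" "t \<in> M" by blast
  then show "h \<in> group_algebra M {\<iota>, \<sigma>, \<sigma>\<sigma>}"
    using keys_tri assms by (auto simp: group_algebra_def lookup_tri)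
qed

text \<open>Both \<open>act\<close> and \<open>galois_twist\<close> sum over the support, which
  varies with the coefficients. Terms with coefficient 0 vanish, so the sum may run over all of
  J.\<close>

lemma sum_keys_tri:
  assumes "\<And>j. f 0 j = (0 :: 'b :: comm_monoid_add)"
  shows "(\<Sum>j\<in>Poly_Mapping.keys (tri x y t). f (Poly_Mapping.lookup (tri x y t) j) j) =
    f x \<iota> + (f y \<sigma> + f t \<sigma>\<sigma>)"
proof -
  have "(\<Sum>j\<in>Poly_Mapping.keys (tri x y t). f (Poly_Mapping.lookup (tri x y t) j) j) =
      (\<Sum>j\<in>{\<iota>, \<sigma>, \<sigma>\<sigma>}. f (Poly_Mapping.lookup (tri x y t) j) j)"
    by (rule sum.mono_neutral_left) (use keys_tri assms in \<open>auto simp: in_keys_iff\<close>)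
  then show ?thesis using distinct_powers by simp
qed

lemma act_tri: "u \<in> Lt \<Longrightarrow> act (tri x y t) u = x * u + y * \<sigma> u + t * \<sigma> (\<sigma> u)"
  unfolding act_def by (subst sum_keys_tri [of "\<lambda>c j. c * j u"]) simp_all

text \<open>The conjugates \<open>j\<close> and \<open>k\<close> are prescribed by commutation
  rules, so that the inverse of \<tau> only has to be cancelled.\<close>

lemma twist_tri:
  assumes "\<tau> \<in> Bij Lt" "\<tau> 0 = 0" "j \<in> Bij Lt" "k \<in> Bij Lt"
    and "\<tau> \<otimes>\<^bsub>B\<^esub> \<sigma> = j \<otimes>\<^bsub>B\<^esub> \<tau>" "\<tau> \<otimes>\<^bsub>B\<^esub> \<sigma>\<sigma> = k \<otimes>\<^bsub>B\<^esub> \<tau>"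
  shows "galois_twist Lt \<tau> (tri x y t) =
    Poly_Mapping.single \<iota> (\<tau> x) + (Poly_Mapping.single j (\<tau> y) + Poly_Mapping.single k (\<tau> t))"
proof -
  have "\<tau> \<otimes>\<^bsub>B\<^esub> \<iota> \<otimes>\<^bsub>B\<^esub> inv\<^bsub>B\<^esub> \<tau> = \<iota>"
    using assms(1) B.r_inv by simp
  moreover have "(j \<otimes>\<^bsub>B\<^esub> \<tau>) \<otimes>\<^bsub>B\<^esub> inv\<^bsub>B\<^esub> \<tau> = j" if "j \<in> Bij Lt" for j
    using assms(1) that B.m_assoc [of j \<tau> "inv\<^bsub>B\<^esub> \<tau>"] B.r_inv B.inv_closed [of \<tau>] by simp
  ultimately show ?thesis
    unfolding galois_twist_def
    by (subst sum_keys_tri [of "\<lambda>c j. Poly_Mapping.single (\<tau> \<otimes>\<^bsub>B\<^esub> j \<otimes>\<^bsub>B\<^esub> inv\<^bsub>B\<^esub> \<tau>) (\<tau> c)"])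
      (simp_all add: assms)
qed

text \<open>An automorphism over L fixes \<alpha>, hence fixes or exchanges the other two roots. The
  exchange reverses the sign of \<delta> and conjugates \<sigma> into its square.\<close>

lemma Gal_Lt_L_cases:
  assumes \<tau>: "\<tau> \<in> Gal Lt L"
  shows "\<tau> = \<iota> \<or> (\<tau> z = - z \<and> \<tau> \<otimes>\<^bsub>B\<^esub> \<sigma> = \<sigma>\<sigma> \<otimes>\<^bsub>B\<^esub> \<tau> \<and> \<tau> \<otimes>\<^bsub>B\<^esub> \<sigma>\<sigma> = \<sigma> \<otimes>\<^bsub>B\<^esub> \<tau>)"
proof -
  have Bij: "\<tau> \<in> Bij Lt" by (rule Gal_Bij [OF \<tau>])
  interpret \<tau>: complex_embedding Lt \<tau>
    by (rule complex_embedding_Gal [OF Lt.complex_subfield_axioms \<tau>])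
  have \<tau>\<alpha>: "\<tau> \<alpha> = \<alpha>" using \<tau> by (simp add: Gal_def)
  have "\<tau> (\<alpha>2 ^ 3) = \<tau> (of_int a * \<alpha>2 + of_int (- b))" using root_iff [of \<alpha>2] by simp
  then have "\<tau> \<alpha>2 ^ 3 = of_int a * \<tau> \<alpha>2 + of_int (- b)" by (simp del: of_int_minus)
  then have "\<tau> \<alpha>2 = \<alpha> \<or> \<tau> \<alpha>2 = \<alpha>2 \<or> \<tau> \<alpha>2 = \<alpha>3" by (simp only: root_iff)
  moreover have "\<tau> \<alpha>2 \<noteq> \<alpha>" using \<tau>.hom_inj [of \<alpha> \<alpha>2] \<tau>\<alpha> distinct_roots by auto
  ultimately consider "\<tau> \<alpha>2 = \<alpha>2" | "\<tau> \<alpha>2 = \<alpha>3" by blast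
  then show ?thesis
  proof cases
    case 1
    have "\<tau> = \<iota>"
      by (rule embedding_eqI [OF \<tau>.complex_embedding_axioms Bij embedding_\<iota> \<iota>_Bij])
        (simp_all add: \<tau>\<alpha> 1)
    then show ?thesis ..
  next
    case 2
    have 3: "\<tau> \<alpha>3 = \<alpha>2"
      using embedding_\<alpha>3 [OF \<tau>.complex_embedding_axioms] 2 \<tau>\<alpha> \<alpha>3_eq by simp
    have "(\<alpha> - \<alpha>3) * (\<alpha>3 - \<alpha>2) * (\<alpha>2 - \<alpha>) = - \<delta>"
      unfolding \<delta>_def by Groebner_Basis.algebra
    then have "\<tau> z = - z"
      using z_cases embedding_z [OF \<tau>.complex_embedding_axioms] unfolding 2 3 \<tau>\<alpha> by auto
    moreover have "\<tau> \<otimes>\<^bsub>B\<^esub> \<sigma> = \<sigma>\<sigma> \<otimes>\<^bsub>B\<^esub> \<tau>" "\<tau> \<otimes>\<^bsub>B\<^esub> \<sigma>\<sigma> = \<sigma> \<otimes>\<^bsub>B\<^esub> \<tau>"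
      by (intro embedding_eqI embedding_mult \<sigma>.complex_embedding_axioms
          \<tau>.complex_embedding_axioms embedding_\<sigma>\<sigma> Bij \<sigma>_Bij \<sigma>\<sigma>_Bij B_mult_Bij;
          simp add: \<sigma>_Bij Bij 2 3 \<tau>\<alpha>)+
    ultimately show ?thesis by simp
  qed
qed

lemma swap_exists:
  assumes zL: "z \<notin> L"
  obtains \<tau> where "\<tau> \<in> Gal Lt L" "\<tau> z = - z"
proof -
  \<comment> \<open>Different coefficients of \<open>z\<close> would exhibit \<open>z\<close> as a
    quotient of elements of L.\<close>
  have unique: "u = u' \<and> v = v'" if "u + v * z = u' + v' * z" and "u \<in> L" "v \<in> L" "u' \<in> L" "v' \<in> L" for u v u' v'
  proof -
    have eq: "(v - v') * z = u' - u" using that(1) by (simp add: algebra_simps)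
    have "v = v'"
    proof (rule ccontr)
      assume "v \<noteq> v'"
      then have "z = (u' - u) / (v - v')" using eq by (simp add: field_simps)
      then show False using zL that by simp
    qed
    then show ?thesis using that(1) by simp
  qed
  \<comment> \<open>Uniqueness makes the description well defined; the restriction to
    \<open>Lt\<close> makes the function extensional, as \<open>Gal\<close> requires.\<close>
  define \<tau> where "\<tau> = (\<lambda>x\<in>Lt. THE y. \<exists>u\<in>L. \<exists>v\<in>L. x = u + v * z \<and> y = u - v * z)"
  have mem: "u + v * z \<in> Lt" if "u \<in> L" "v \<in> L" for u v
    using that unfolding Lt_eq by blast
  have \<tau>: "\<tau> (u + v * z) = u - v * z" if uv: "u \<in> L" "v \<in> L" for u v
  proof -
    have "(THE y. \<exists>u'\<in>L. \<exists>v'\<in>L. u + v * z = u' + v' * z \<and> y = u' - v' * z) = u - v * z"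
      by (rule the_equality) (use uv unique [OF _ uv] in blast)+
    then show ?thesis using mem [OF uv] by (simp add: \<tau>_def)
  qed
  have \<tau>': "\<tau> (u - v * z) = u + v * z" if "u \<in> L" "v \<in> L" for u v
    using \<tau> [of u "- v"] that by simp
  have split: "\<exists>u\<in>L. \<exists>v\<in>L. x = u + v * z" if "x \<in> Lt" for x
    using that unfolding Lt_eq by blast
  have \<tau>_Lt: "\<tau> x \<in> Lt \<and> \<tau> (\<tau> x) = x" if x_Lt: "x \<in> Lt" for x
  proof -
    obtain u v where x: "x = u + v * z" and uv: "u \<in> L" "v \<in> L" using split [OF x_Lt] by blast
    show ?thesis using mem [of u "- v"] uv by (simp add: x \<tau> \<tau>')
  qed
  have z2: "z ^ 2 \<in> L" using z_square_Rats by (rule L.Rats_mem)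
  have "complex_embedding Lt \<tau>"
  proof
    show "\<tau> 1 = 1" using \<tau> [of 1 0] by simp
    fix x y assume "x \<in> Lt" "y \<in> Lt"
    then obtain u v u' v' where x: "x = u + v * z" and y: "y = u' + v' * z"
      and L: "u \<in> L" "v \<in> L" "u' \<in> L" "v' \<in> L"
      using split by metis
    have "x + y = (u + u') + (v + v') * z" by (simp add: x y algebra_simps)
    then have "\<tau> (x + y) = (u + u') - (v + v') * z" using L by (simp only: \<tau> L.add)
    then show "\<tau> (x + y) = \<tau> x + \<tau> y" using L by (simp add: x y \<tau> algebra_simps)
    have "x * y = (u * u' + v * v' * z ^ 2) + (u * v' + v * u') * z"
      by (simp add: x y algebra_simps power2_eq_square)
    then have "\<tau> (x * y) = (u * u' + v * v' * z ^ 2) - (u * v' + v * u') * z"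
      using L z2 by (simp only: \<tau> L.add L.mult)
    then show "\<tau> (x * y) = \<tau> x * \<tau> y" using L by (simp add: x y \<tau> algebra_simps power2_eq_square)
  qed
  moreover have "\<tau> \<in> Bij Lt"
  proof -
    \<comment> \<open>The map is an involution, so it serves as its own inverse.\<close>
    have "bij_betw \<tau> Lt Lt"
      by (rule bij_betw_byWitness [of _ \<tau>]) (use \<tau>_Lt in auto)
    then show ?thesis by (simp add: Bij_def \<tau>_def)
  qed
  moreover have "\<tau> x = x" if "x \<in> L" for x using \<tau> [of x 0] that by simp
  ultimately have "\<tau> \<in> Gal Lt L" by (rule GalI)
  then show ?thesis using that \<tau> [of 0 1] by simp
qed

lemma fixed_algebra_eq:
  "fixed_algebra Lt (Q_adjoin {z}) (generate B {\<sigma>}) (Gal Lt L) =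
    {tri p (r + q * z) (r - q * z) | p q r. p \<in> \<rat> \<and> q \<in> \<rat> \<and> r \<in> \<rat>}" (is "?H = ?T")
proof -
  let ?M = "Q_adjoin {z}"
  interpret M: complex_subfield ?M by (rule complex_subfield_Q_adjoin)
  have z_M: "z \<in> ?M" by (rule Q_adjoin_incl) simp
  have M_eq: "?M = {u + v * z | u v. u \<in> \<rat> \<and> v \<in> \<rat>}"
    by (rule Q_adjoin_quadratic [OF z_square_Rats])
  have H_eq: "?H = {h. (\<exists>x y t. h = tri x y t \<and> x \<in> ?M \<and> y \<in> ?M \<and> t \<in> ?M) \<and>
      (\<forall>\<tau>\<in>Gal Lt L. galois_twist Lt \<tau> h = h)}"
    unfolding fixed_algebra_def generate_\<sigma> group_algebra_eq [OF M.zero] by blast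
  have M_Lt: "?M \<subseteq> Lt"
    by (rule Q_adjoin_subset [OF Lt.complex_subfield_axioms]) simp
  have swap: "galois_twist Lt \<tau> (tri x y t) = tri (\<tau> x) (\<tau> t) (\<tau> y)"
    if "\<tau> \<in> Gal Lt L" "\<tau> \<otimes>\<^bsub>B\<^esub> \<sigma> = \<sigma>\<sigma> \<otimes>\<^bsub>B\<^esub> \<tau>" "\<tau> \<otimes>\<^bsub>B\<^esub> \<sigma>\<sigma> = \<sigma> \<otimes>\<^bsub>B\<^esub> \<tau>" for \<tau> x y t
  proof -
    interpret \<tau>: complex_embedding Lt \<tau>
      by (rule complex_embedding_Gal [OF Lt.complex_subfield_axioms that(1)])
    show ?thesis
      using twist_tri [OF Gal_Bij [OF that(1)] \<tau>.hom_zero \<sigma>\<sigma>_Bij \<sigma>_Bij that(2,3)]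
      by (simp add: tri_def add_ac)
  qed
  show ?thesis
  proof (intro equalityI subsetI)
    fix h assume "h \<in> ?H"
    then obtain x y t where h: "h = tri x y t" and M: "x \<in> ?M" "y \<in> ?M" "t \<in> ?M"
      and fixed: "\<And>\<tau>. \<tau> \<in> Gal Lt L \<Longrightarrow> galois_twist Lt \<tau> h = h"
      unfolding H_eq by blast
    obtain p q r s where x: "x = p + q * z" and y: "y = r + s * z"
      and Q: "p \<in> \<rat>" "q \<in> \<rat>" "r \<in> \<rat>" "s \<in> \<rat>"
      using M(1,2) unfolding M_eq by blast
    show "h \<in> ?T"
    proof (cases "z \<in> L")
      case True
      then have "z \<in> \<rat>" by (rule z_L_imp_Rats)
      \<comment> \<open>All coefficients are rational here, and any \<open>y\<close> and
        \<open>t\<close> have the required shape: \<open>r\<close> is half their sum and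
        \<open>q\<close> half their difference divided by \<open>z\<close>.\<close>
      then have "?M \<subseteq> \<rat>" by (intro Q_adjoin_subset complex_subfield_Rats) simp
      then have Q': "x \<in> \<rat>" "y \<in> \<rat>" "t \<in> \<rat>" using M by auto
      have "h = tri x ((y + t) / 2 + (y - t) / (2 * z) * z) ((y + t) / 2 - (y - t) / (2 * z) * z)"
        unfolding h tri_eq_iff using z_nonzero by (simp add: field_simps)
      moreover have "(y + t) / 2 \<in> \<rat>" "(y - t) / (2 * z) \<in> \<rat>"
        using Q' \<open>z \<in> \<rat>\<close> by auto
      ultimately show ?thesis using Q'(1) by blast
    next
      case False
      obtain \<tau> where \<tau>: "\<tau> \<in> Gal Lt L" "\<tau> z = - z" using swap_exists [OF False] .
      interpret \<tau>: complex_embedding Lt \<tau>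
        by (rule complex_embedding_Gal [OF Lt.complex_subfield_axioms \<tau>(1)])
      have "\<tau> \<noteq> \<iota>" using \<tau>(2) z_nonzero by auto
      then have "\<tau> \<otimes>\<^bsub>B\<^esub> \<sigma> = \<sigma>\<sigma> \<otimes>\<^bsub>B\<^esub> \<tau>" "\<tau> \<otimes>\<^bsub>B\<^esub> \<sigma>\<sigma> = \<sigma> \<otimes>\<^bsub>B\<^esub> \<tau>"
        using Gal_Lt_L_cases [OF \<tau>(1)] by auto
      from swap [OF \<tau>(1) this] have "tri (\<tau> x) (\<tau> t) (\<tau> y) = tri x y t"
        using fixed [OF \<tau>(1)] h by simp
      \<comment> \<open>Invariance under the transposition makes \<open>x\<close> rational and
        \<open>t\<close> the conjugate of \<open>y\<close>.\<close>
      then have "\<tau> x = x" "t = \<tau> y" by (simp_all add: tri_eq_iff)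
      then have "q = 0" "t = r - s * z" using Q \<tau>(2) z_nonzero by (simp_all add: x y)
      then show ?thesis using Q unfolding h x y by auto
    qed
  next
    fix h assume "h \<in> ?T"
    then obtain p q r where h: "h = tri p (r + q * z) (r - q * z)"
      and Q: "p \<in> \<rat>" "q \<in> \<rat>" "r \<in> \<rat>" by blast
    have "p \<in> ?M" "r + q * z \<in> ?M" "r - q * z \<in> ?M" using Q z_M by simp_all
    moreover have "galois_twist Lt \<tau> h = h" if \<tau>: "\<tau> \<in> Gal Lt L" for \<tau>
      using Gal_Lt_L_cases [OF \<tau>]
    proof
      assume "\<tau> = \<iota>"
      have "p \<in> Lt" "r + q * z \<in> Lt" "r - q * z \<in> Lt" using Q by simp_all
      then show ?thesis
        unfolding h \<open>\<tau> = \<iota>\<close>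
        by (subst twist_tri [of \<iota> \<sigma> \<sigma>\<sigma>]) (simp_all add: \<sigma>_Bij tri_def add_ac)
    next
      interpret \<tau>: complex_embedding Lt \<tau>
        by (rule complex_embedding_Gal [OF Lt.complex_subfield_axioms \<tau>])
      assume *: "\<tau> z = - z \<and> \<tau> \<otimes>\<^bsub>B\<^esub> \<sigma> = \<sigma>\<sigma> \<otimes>\<^bsub>B\<^esub> \<tau> \<and> \<tau> \<otimes>\<^bsub>B\<^esub> \<sigma>\<sigma> = \<sigma> \<otimes>\<^bsub>B\<^esub> \<tau>"
      \<comment> \<open>Conjugating the coefficients and exchanging their positions cancel each
        other.\<close>
      then show ?thesis
        unfolding h using Q by (simp add: swap [OF \<tau>])
    qed
    ultimately show "h \<in> ?H" unfolding H_eq h by blast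
  qed
qed

end

section \<open>The associated order\<close>

context cubic_roots
begin

text \<open>This is \<open>x w1 + y w2 + t w3\<close> in the notation of the theorem:
  \<open>w2\<close> contributes \<open>z\<close> at \<sigma> and \<open>- z\<close> at its
  square.\<close>

definition comb :: "complex \<Rightarrow> complex \<Rightarrow> complex \<Rightarrow> ((complex \<Rightarrow> complex) \<Rightarrow>\<^sub>0 complex)" where
  "comb x y t = tri x (t + y * z) (t - y * z)"

lemma comb_eq_iff: "comb x y t = comb x' y' t' \<longleftrightarrow> x = x' \<and> y = y' \<and> t = t'"
proof
  assume "comb x y t = comb x' y' t'"
  then have "x = x'" and plus: "t + y * z = t' + y' * z" and minus: "t - y * z = t' - y' * z"
    by (simp_all add: comb_def tri_eq_iff)
  have "2 * t = 2 * t'" using plus minus by Groebner_Basis.algebra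
  moreover from this have "y * z = y' * z" using plus by simp
  ultimately show "x = x' \<and> y = y' \<and> t = t'" using \<open>x = x'\<close> z_nonzero by simp
qed simp

lemma comb_add: "comb x y t + comb x' y' t' = comb (x + x') (y + y') (t + t')"
  by (simp add: comb_def tri_add tri_eq_iff algebra_simps)

lemma comb_diff: "comb x y t - comb x' y' t' = comb (x - x') (y - y') (t - t')"
  by (simp add: comb_def tri_diff tri_eq_iff algebra_simps)

lemma comb_scl: "scl c (comb x y t) = comb (c * x) (c * y) (c * t)"
  by (simp add: comb_def tri_scl tri_eq_iff algebra_simps)

lemma comb_eq_0_iff: "comb x y t = 0 \<longleftrightarrow> x = 0 \<and> y = 0 \<and> t = 0"
proof -
  have "comb 0 0 0 = 0" by (simp add: comb_def tri_zero)
  then show ?thesis using comb_eq_iff [of x y t 0 0 0] by simp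
qed

section \<open>Integrality conditions for membership in the associated order\<close>

abbreviation "H \<equiv> fixed_algebra Lt (Q_adjoin {z}) (generate B {\<sigma>}) (Gal Lt L)"
abbreviation "A \<equiv> associated_order H (Z_adjoin \<alpha>)"

lemma H_eq: "H = {comb x y t | x y t. x \<in> \<rat> \<and> y \<in> \<rat> \<and> t \<in> \<rat>}"
  unfolding fixed_algebra_eq comb_def ..

lemma comb_H_iff: "comb x y t \<in> H \<longleftrightarrow> x \<in> \<rat> \<and> y \<in> \<rat> \<and> t \<in> \<rat>"
  unfolding H_eq by (auto simp: comb_eq_iff)

lemma act_comb: "u \<in> Lt \<Longrightarrow> act (comb x y t) u = x * u + t * (\<sigma> u + \<sigma> (\<sigma> u)) + y * (z * (\<sigma> u - \<sigma> (\<sigma> u)))"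
  unfolding comb_def by (simp add: act_tri algebra_simps)

text \<open>The product \<open>\<delta> * (\<alpha>2 - \<alpha>3)\<close> equals
  \<open>(a - 3 * \<alpha> ^ 2) * (4 * a - 3 * \<alpha> ^ 2)\<close>, so only powers of \<alpha>
  remain, and the cubic relation reduces them. The sign \<open>\<epsilon>\<close> records which
  square root of the discriminant \<open>z\<close> is.\<close>

lemma act_comb_basis:
  obtains \<epsilon> :: complex where "\<epsilon> = 1 \<or> \<epsilon> = - 1"
    and "\<And>x y t. act (comb x y t) 1 = x + 2 * t"
    and "\<And>x y t. act (comb x y t) \<alpha> =
      4 * of_int a ^ 2 * (\<epsilon> * y) + (x - t - 9 * of_int b * (\<epsilon> * y)) * \<alpha>
      + (- 6 * of_int a * (\<epsilon> * y)) * \<alpha> ^ 2"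
    and "\<And>x y t. act (comb x y t) (\<alpha> ^ 2) =
      (2 * of_int a * t - 6 * of_int a * of_int b * (\<epsilon> * y)) + 2 * of_int a ^ 2 * (\<epsilon> * y) * \<alpha>
      + (x - t + 9 * of_int b * (\<epsilon> * y)) * \<alpha> ^ 2"
proof -
  obtain \<epsilon> :: complex where \<epsilon>: "\<epsilon> = 1 \<or> \<epsilon> = - 1" and z\<delta>: "z = \<epsilon> * \<delta>"
    using z_cases by (metis mult_1 mult_minus1)
  have 1: "act (comb x y t) 1 = x + 2 * t" for x y t
    by (simp add: act_comb)
  have 2: "act (comb x y t) \<alpha> =
      4 * of_int a ^ 2 * (\<epsilon> * y) + (x - t - 9 * of_int b * (\<epsilon> * y)) * \<alpha>
      + (- 6 * of_int a * (\<epsilon> * y)) * \<alpha> ^ 2" for x y t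
  proof -
    have "act (comb x y t) \<alpha> = x * \<alpha> + t * (\<alpha>2 + \<alpha>3) + y * (\<epsilon> * \<delta> * (\<alpha>2 - \<alpha>3))"
      by (simp add: act_comb flip: z\<delta>)
    also have "\<dots> = 4 * of_int a ^ 2 * (\<epsilon> * y) + (x - t - 9 * of_int b * (\<epsilon> * y)) * \<alpha>
      + (- 6 * of_int a * (\<epsilon> * y)) * \<alpha> ^ 2"
      unfolding \<delta>_def unfolding a_eq b_eq unfolding \<alpha>3_eq by Groebner_Basis.algebra
    finally show ?thesis .
  qed
  have 3: "act (comb x y t) (\<alpha> ^ 2) =
      (2 * of_int a * t - 6 * of_int a * of_int b * (\<epsilon> * y)) + 2 * of_int a ^ 2 * (\<epsilon> * y) * \<alpha>
      + (x - t + 9 * of_int b * (\<epsilon> * y)) * \<alpha> ^ 2" for x y t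
  proof -
    have "act (comb x y t) (\<alpha> ^ 2) =
        x * \<alpha> ^ 2 + t * (\<alpha>2 ^ 2 + \<alpha>3 ^ 2) + y * (\<epsilon> * \<delta> * (\<alpha>2 ^ 2 - \<alpha>3 ^ 2))"
      by (simp add: act_comb flip: z\<delta>)
    also have "\<dots> = (2 * of_int a * t - 6 * of_int a * of_int b * (\<epsilon> * y))
      + 2 * of_int a ^ 2 * (\<epsilon> * y) * \<alpha> + (x - t + 9 * of_int b * (\<epsilon> * y)) * \<alpha> ^ 2"
      unfolding \<delta>_def unfolding a_eq b_eq unfolding \<alpha>3_eq by Groebner_Basis.algebra
    finally show ?thesis .
  qed
  show ?thesis by (rule that) (fact \<epsilon> 1 2 3)+
qed

lemma quad_span_Ints_iff:
  assumes "p \<in> \<rat>" "q \<in> \<rat>" "r \<in> \<rat>"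
  shows "p + q * \<alpha> + r * \<alpha> ^ 2 \<in> quad_span \<int> \<alpha> \<longleftrightarrow> p \<in> \<int> \<and> q \<in> \<int> \<and> r \<in> \<int>"
proof
  assume "p + q * \<alpha> + r * \<alpha> ^ 2 \<in> quad_span \<int> \<alpha>"
  then obtain p' q' r' where eq: "p + q * \<alpha> + r * \<alpha> ^ 2 = p' + q' * \<alpha> + r' * \<alpha> ^ 2"
    and Z: "p' \<in> \<int>" "q' \<in> \<int>" "r' \<in> \<int>" by (rule quad_spanE)
  then have "(p - p') + (q - q') * \<alpha> + (r - r') * \<alpha> ^ 2 = 0" by (simp add: algebra_simps)
  then have "p - p' = 0 \<and> q - q' = 0 \<and> r - r' = 0"
    using assms Z Ints_subset_Rats by (intro indep Rats_diff) auto
  then show "p \<in> \<int> \<and> q \<in> \<int> \<and> r \<in> \<int>" using Z by simp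
qed (auto intro: quad_spanI)

text \<open>As \<sigma> fixes \<rat>, the action is linear over \<rat>, and it suffices to test the
  three generators of \<int>[\<alpha>].\<close>

lemma comb_mem_A_iff_basis:
  "comb x y t \<in> A \<longleftrightarrow> comb x y t \<in> H \<and> act (comb x y t) 1 \<in> quad_span \<int> \<alpha> \<and>
    act (comb x y t) \<alpha> \<in> quad_span \<int> \<alpha> \<and> act (comb x y t) (\<alpha> ^ 2) \<in> quad_span \<int> \<alpha>"
    (is "_ \<longleftrightarrow> ?rhs")
proof
  let ?h = "comb x y t"
  have "1 \<in> quad_span \<int> \<alpha>" "\<alpha> \<in> quad_span \<int> \<alpha>" "\<alpha> ^ 2 \<in> quad_span \<int> \<alpha>"
    using complex_subring.one [OF quad_span_Ints] \<alpha>_quad_span [OF complex_subring_Ints]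
      complex_subring.power [OF quad_span_Ints] by auto
  then show "?h \<in> A \<Longrightarrow> ?rhs"
    unfolding associated_order_def Z_adjoin_eq by blast
  assume rhs: ?rhs
  have "act ?h u \<in> quad_span \<int> \<alpha>" if u_mem: "u \<in> quad_span \<int> \<alpha>" for u
  proof -
    interpret Z: complex_subring "quad_span \<int> \<alpha>" by (rule quad_span_Ints)
    obtain p q r where u: "u = p + q * \<alpha> + r * \<alpha> ^ 2" and Z: "p \<in> \<int>" "q \<in> \<int>" "r \<in> \<int>"
      using u_mem by (rule quad_spanE)
    then have Q: "p \<in> \<rat>" "q \<in> \<rat>" "r \<in> \<rat>" using Ints_subset_Rats by auto
    have "act ?h u = p * act ?h 1 + q * act ?h \<alpha> + r * act ?h (\<alpha> ^ 2)"
      using Q by (simp add: act_comb u algebra_simps)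
    also have "\<dots> \<in> quad_span \<int> \<alpha>"
      using Z rhs by (auto elim!: Ints_cases)
    finally show ?thesis .
  qed
  then show "?h \<in> A" using rhs unfolding associated_order_def Z_adjoin_eq by blast
qed

text \<open>The images of the three generators have seven coordinates to test. Divisibility of
  \<open>a\<close> by 3 makes \<open>4 * a ^ 2 * y\<close>, \<open>2 * a ^ 2 * y\<close> and the
  constant term of the image of \<open>\<alpha> ^ 2\<close> consequences of the other four.\<close>

lemma comb_mem_A_iff:
  assumes "3 dvd a"
  shows "comb x y t \<in> A \<longleftrightarrow> x \<in> \<rat> \<and> y \<in> \<rat> \<and> t \<in> \<rat> \<and> x + 2 * t \<in> \<int> \<and> 6 * of_int a * y \<in> \<int> \<and>
    x - t - 9 * of_int b * y \<in> \<int> \<and> x - t + 9 * of_int b * y \<in> \<int>"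
proof (cases "x \<in> \<rat> \<and> y \<in> \<rat> \<and> t \<in> \<rat>")
  case True
  then have Q: "x \<in> \<rat>" "y \<in> \<rat>" "t \<in> \<rat>" by auto
  obtain \<epsilon> :: complex where \<epsilon>: "\<epsilon> = 1 \<or> \<epsilon> = - 1"
    and act: "\<And>x y t. act (comb x y t) 1 = x + 2 * t"
    "\<And>x y t. act (comb x y t) \<alpha> =
      4 * of_int a ^ 2 * (\<epsilon> * y) + (x - t - 9 * of_int b * (\<epsilon> * y)) * \<alpha>
      + (- 6 * of_int a * (\<epsilon> * y)) * \<alpha> ^ 2"
    "\<And>x y t. act (comb x y t) (\<alpha> ^ 2) =
      (2 * of_int a * t - 6 * of_int a * of_int b * (\<epsilon> * y)) + 2 * of_int a ^ 2 * (\<epsilon> * y) * \<alpha>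
      + (x - t + 9 * of_int b * (\<epsilon> * y)) * \<alpha> ^ 2"
    by (rule act_comb_basis) blast
  define Y where "Y = \<epsilon> * y"
  have Y: "Y = y \<or> Y = - y" using \<epsilon> by (auto simp: Y_def)
  then have YQ: "Y \<in> \<rat>" using Q by auto
  obtain c where c: "a = 3 * c" using assms by (rule dvdE)
  have "comb x y t \<in> A \<longleftrightarrow> x + 2 * t \<in> \<int> \<and>
    (4 * of_int a ^ 2 * Y \<in> \<int> \<and> x - t - 9 * of_int b * Y \<in> \<int> \<and> - 6 * of_int a * Y \<in> \<int>) \<and>
    (2 * of_int a * t - 6 * of_int a * of_int b * Y \<in> \<int> \<and> 2 * of_int a ^ 2 * Y \<in> \<int> \<and>
      x - t + 9 * of_int b * Y \<in> \<int>)"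
  proof -
    have "x + 2 * t \<in> quad_span \<int> \<alpha> \<longleftrightarrow> x + 2 * t \<in> \<int>"
      using quad_span_Ints_iff [of "x + 2 * t" 0 0] Q by simp
    moreover have "4 * of_int a ^ 2 * Y + (x - t - 9 * of_int b * Y) * \<alpha> + (- 6 * of_int a * Y) * \<alpha> ^ 2
        \<in> quad_span \<int> \<alpha> \<longleftrightarrow>
        4 * of_int a ^ 2 * Y \<in> \<int> \<and> x - t - 9 * of_int b * Y \<in> \<int> \<and> - 6 * of_int a * Y \<in> \<int>"
      by (rule quad_span_Ints_iff) (use Q YQ in auto)
    moreover have "(2 * of_int a * t - 6 * of_int a * of_int b * Y) + 2 * of_int a ^ 2 * Y * \<alpha>
        + (x - t + 9 * of_int b * Y) * \<alpha> ^ 2 \<in> quad_span \<int> \<alpha> \<longleftrightarrow>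
        2 * of_int a * t - 6 * of_int a * of_int b * Y \<in> \<int> \<and> 2 * of_int a ^ 2 * Y \<in> \<int> \<and>
        x - t + 9 * of_int b * Y \<in> \<int>"
      by (rule quad_span_Ints_iff) (use Q YQ in auto)
    ultimately show ?thesis
      unfolding comb_mem_A_iff_basis act comb_H_iff Y_def [symmetric] using Q by simp
  qed
  also have "\<dots> \<longleftrightarrow> x + 2 * t \<in> \<int> \<and> 6 * of_int a * Y \<in> \<int> \<and>
      x - t - 9 * of_int b * Y \<in> \<int> \<and> x - t + 9 * of_int b * Y \<in> \<int>" (is "?l \<longleftrightarrow> ?r")
  proof
    assume ?l
    then show ?r using Ints_minus [of "- 6 * of_int a * Y"] by simp
  next
    assume ?r
    then have r: "x + 2 * t \<in> \<int>" "6 * of_int a * Y \<in> \<int>" "x - t - 9 * of_int b * Y \<in> \<int>"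
      "x - t + 9 * of_int b * Y \<in> \<int>" by auto
    have "2 * of_int a ^ 2 * Y = of_int c * (6 * of_int a * Y)"
      unfolding c by (simp add: power2_eq_square algebra_simps)
    then have i: "2 * of_int a ^ 2 * Y \<in> \<int>" using Ints_mult [OF Ints_of_int r(2)] by (simp only:)
    have "4 * of_int a ^ 2 * Y = 2 * (2 * of_int a ^ 2 * Y)" by simp
    then have ii: "4 * of_int a ^ 2 * Y \<in> \<int>" using i by (metis Ints_mult Ints_numeral)
    have "2 * of_int a * t - 6 * of_int a * of_int b * Y =
        2 * of_int c * ((x + 2 * t) - (x - t + 9 * of_int b * Y))"
      unfolding c by (simp add: algebra_simps)
    then have iii: "2 * of_int a * t - 6 * of_int a * of_int b * Y \<in> \<int>"
      using r by (metis Ints_diff Ints_mult Ints_numeral Ints_of_int)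
    have "- 6 * of_int a * Y \<in> \<int>" using Ints_minus [OF r(2)] by simp
    then show ?l using r i ii iii by blast
  qed
  \<comment> \<open>Changing the sign of \<open>y\<close> exchanges the last two conditions and
    negates \<open>6 * a * y\<close>, so \<open>\<epsilon>\<close> disappears.\<close>
  also have "\<dots> \<longleftrightarrow> x + 2 * t \<in> \<int> \<and> 6 * of_int a * y \<in> \<int> \<and>
      x - t - 9 * of_int b * y \<in> \<int> \<and> x - t + 9 * of_int b * y \<in> \<int>"
    using Y by (auto simp: minus_in_Ints_iff)
  finally show ?thesis using Q by simp
next
  case False
  then show ?thesis unfolding comb_mem_A_iff_basis comb_H_iff by blast
qed

lemma A_subset_H: "A \<subseteq> H"
  by (auto simp: associated_order_def)

lemma Q_basis_H: "Q_basis (vector [comb 1 0 0, comb 0 1 0, comb 0 0 1] :: _ ^ 3) H"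
proof -
  have module: "Modules.module (\<lambda>q::rat. scl (of_rat q) :: ((complex \<Rightarrow> complex) \<Rightarrow>\<^sub>0 complex) \<Rightarrow> _)"
    using vector_space_scl_rat by (simp add: module_iff_vector_space)
  have "H = {comb (of_rat x) (of_rat y) (of_rat t) | x y t. True}"
    unfolding H_eq by (auto simp: comb_eq_iff elim!: Rats_cases)
  then show ?thesis
    unfolding basis_of_vector_3 [OF module] by (simp add: comb_scl comb_add comb_eq_0_iff)
qed

section \<open>Explicit bases of the associated order and the value of the index\<close>

context
  fixes d m :: int
  assumes three: "3 dvd a" and d: "d = gcd a (3 * b)" and m: "3 * b = d * m"
begin

lemma d_nonzero: "d \<noteq> 0"
  using b_nonzero by (simp add: d)

text \<open>The last two conditions differ by \<open>18 * b * y\<close>; together with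
  \<open>6 * a * y\<close>, a Bezout identity for \<open>a\<close> and \<open>3 * b\<close> yields
  \<open>6 * d * y\<close>.\<close>

lemma six_d_Ints:
  fixes y :: complex
  assumes "6 * of_int a * y \<in> \<int>" "x - t - 9 * of_int b * y \<in> \<int>" "x - t + 9 * of_int b * y \<in> \<int>"
  shows "6 * of_int d * y \<in> \<int>"
proof -
  obtain u v where "u * a + v * (3 * b) = d" unfolding d using bezout_int by blast
  then have "6 * of_int d * y = 6 * of_int (u * a + v * (3 * b)) * y" by simp
  also have "\<dots> = of_int u * (6 * of_int a * y)
      + of_int v * ((x - t + 9 * of_int b * y) - (x - t - 9 * of_int b * y))"
    by (simp add: algebra_simps)
  also have "\<dots> \<in> \<int>" by (rule Ints_add [OF Ints_mult [OF Ints_of_int assms(1)]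
          Ints_mult [OF Ints_of_int Ints_diff [OF assms(3,2)]]])
  finally show ?thesis .
qed

text \<open>Both \<open>3 * t\<close> and \<open>3 * d * y\<close> may be half-integers. As
  \<open>9 * b\<close> is an odd multiple of \<open>3 * d\<close>, the conditions allow this only
  for both at once, which the third basis vector realises.\<close>

lemma Z_basis_odd:
  assumes "odd m"
  shows "Z_basis (vector [comb 1 0 0, comb 0 (1 / (3 * of_int d)) 0,
    comb (- 1 / 3) (- 1 / (6 * of_int d)) (1 / 6)] :: _ ^ 3) A" (is "Z_basis ?v A")
proof -
  let ?c = "\<lambda>n k l :: int. comb (of_int n - of_int l / 3)
    ((2 * of_int k - of_int l) / (6 * of_int d)) (of_int l / 6)"
  have lin: "scl (of_int n) (comb 1 0 0) + scl (of_int k) (comb 0 (1 / (3 * of_int d)) 0) +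
      scl (of_int l) (comb (- 1 / 3) (- 1 / (6 * of_int d)) (1 / 6)) = ?c n k l" for n k l
    using d_nonzero by (simp add: comb_scl comb_add comb_eq_iff field_simps)
  obtain s where s: "m = 2 * s + 1" using assms by (rule oddE)
  obtain a' where a': "a = d * a'" using d by (metis dvdE gcd_dvd1)
  have nine: "9 * of_int b = (3 * of_int d * (2 * of_int s + 1) :: complex)"
  proof -
    have "9 * b = 3 * d * (2 * s + 1)" using m s by simp
    then have "of_int (9 * b) = (of_int (3 * d * (2 * s + 1)) :: complex)" by (rule arg_cong)
    then show ?thesis by simp
  qed
  have "A = {?c n k l | n k l. True}"
  proof (intro equalityI subsetI)
    fix h assume h: "h \<in> A"
    then obtain x y t where hc: "h = comb x y t" using A_subset_H unfolding H_eq by blast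
    have i: "x + 2 * t \<in> \<int>" "6 * of_int a * y \<in> \<int>" "x - t - 9 * of_int b * y \<in> \<int>"
      "x - t + 9 * of_int b * y \<in> \<int>"
      using h unfolding hc comb_mem_A_iff [OF three] by auto
    have dy: "6 * of_int d * y \<in> \<int>" by (rule six_d_Ints [OF i(2-4)])
    have "6 * t = 2 * (x + 2 * t) - (x - t - 9 * of_int b * y) - (x - t + 9 * of_int b * y)"
      by (simp add: algebra_simps)
    also have "\<dots> \<in> \<int>" by (rule Ints_diff [OF Ints_diff [OF Ints_mult [OF Ints_numeral i(1)] i(3)] i(4)])
    finally obtain l where l: "6 * t = of_int l" by (rule Ints_cases)
    \<comment> \<open>Subtracting \<open>s\<close> copies of the integer \<open>6 * d * y\<close>
      leaves the coupling between \<open>y\<close> and \<open>t\<close>; its value is the second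
      coordinate \<open>k\<close>.\<close>
    have "3 * of_int d * y + 3 * t =
        (x + 2 * t) - (x - t - 9 * of_int b * y) - of_int s * (6 * of_int d * y)"
      unfolding nine by (simp add: algebra_simps)
    also have "\<dots> \<in> \<int>" by (rule Ints_diff [OF Ints_diff [OF i(1,3)] Ints_mult [OF Ints_of_int dy]])
    finally obtain k where k: "3 * of_int d * y + 3 * t = of_int k" by (rule Ints_cases)
    obtain n where n: "x + 2 * t = of_int n" using i(1) by (rule Ints_cases)
    have "x = of_int n - of_int l / 3" "t = of_int l / 6"
      using n l by (auto simp: field_simps simp flip: l n)
    moreover have "y = (2 * of_int k - of_int l) / (6 * of_int d)"
      using d_nonzero by (simp add: field_simps flip: k l)
    ultimately have "h = ?c n k l" unfolding hc comb_eq_iff by blast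
    then show "h \<in> {?c n k l | n k l. True}" by blast
  next
    fix h assume "h \<in> {?c n k l | n k l. True}"
    then obtain n k l where h: "h = ?c n k l" by blast
    have "6 * of_int a * ((2 * of_int k - of_int l) / (6 * of_int d)) = (of_int (a' * (2 * k - l)) :: complex)"
      using d_nonzero by (simp add: a')
    moreover have "of_int n - of_int l / 3 + 2 * (of_int l / 6) = (of_int n :: complex)"
      by simp
    moreover have "of_int n - of_int l / 3 - of_int l / 6
        - 9 * of_int b * ((2 * of_int k - of_int l) / (6 * of_int d)) =
        (of_int (n - (2 * s + 1) * k + s * l) :: complex)"
      unfolding nine using d_nonzero by (simp add: field_simps)
    moreover have "of_int n - of_int l / 3 - of_int l / 6
        + 9 * of_int b * ((2 * of_int k - of_int l) / (6 * of_int d)) =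
        (of_int (n + (2 * s + 1) * k - (s + 1) * l) :: complex)"
      unfolding nine using d_nonzero by (simp add: field_simps)
    ultimately show "h \<in> A"
      unfolding h comb_mem_A_iff [OF three] by (simp only: Ints_of_int) simp
  qed
  moreover have "n = 0 \<and> k = 0 \<and> l = 0" if "?c n k l = 0" for n k l
    using that d_nonzero by (auto simp: comb_eq_0_iff)
  ultimately show ?thesis
    unfolding basis_of_vector_3 [OF module_scl_int] lin by blast
qed

text \<open>Now \<open>9 * b\<close> is a multiple of \<open>6 * d\<close>, so
  \<open>9 * b * y\<close> is an integer and the conditions decouple into integrality of
  \<open>x + 2 * t\<close>, \<open>3 * t\<close> and \<open>6 * d * y\<close>.\<close>

lemma Z_basis_even:
  assumes "even m"
  shows "Z_basis (vector [comb 1 0 0, comb 0 (1 / (6 * of_int d)) 0,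
    comb (- 2 / 3) 0 (1 / 3)] :: _ ^ 3) A" (is "Z_basis ?v A")
proof -
  let ?c = "\<lambda>n k l :: int. comb (of_int n - 2 * of_int l / 3) (of_int k / (6 * of_int d)) (of_int l / 3)"
  have lin: "scl (of_int n) (comb 1 0 0) + scl (of_int k) (comb 0 (1 / (6 * of_int d)) 0) +
      scl (of_int l) (comb (- 2 / 3) 0 (1 / 3)) = ?c n k l" for n k l
    by (simp add: comb_scl comb_add comb_eq_iff)
  obtain s where s: "m = 2 * s" using assms by (rule evenE)
  obtain a' where a': "a = d * a'" using d by (metis dvdE gcd_dvd1)
  have nine: "9 * of_int b = (6 * of_int d * of_int s :: complex)"
  proof -
    have "9 * b = 6 * d * s" using m s by simp
    then have "of_int (9 * b) = (of_int (6 * d * s) :: complex)" by (rule arg_cong)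
    then show ?thesis by simp
  qed
  have "A = {?c n k l | n k l. True}"
  proof (intro equalityI subsetI)
    fix h assume h: "h \<in> A"
    then obtain x y t where hc: "h = comb x y t" using A_subset_H unfolding H_eq by blast
    have i: "x + 2 * t \<in> \<int>" "6 * of_int a * y \<in> \<int>" "x - t - 9 * of_int b * y \<in> \<int>"
      "x - t + 9 * of_int b * y \<in> \<int>"
      using h unfolding hc comb_mem_A_iff [OF three] by auto
    have dy: "6 * of_int d * y \<in> \<int>" by (rule six_d_Ints [OF i(2-4)])
    have "3 * t = (x + 2 * t) - (x - t - 9 * of_int b * y) - of_int s * (6 * of_int d * y)"
      unfolding nine by (simp add: algebra_simps)
    also have "\<dots> \<in> \<int>" by (rule Ints_diff [OF Ints_diff [OF i(1,3)] Ints_mult [OF Ints_of_int dy]])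
    finally obtain l where l: "3 * t = of_int l" by (rule Ints_cases)
    obtain k where k: "6 * of_int d * y = of_int k" using dy by (rule Ints_cases)
    obtain n where n: "x + 2 * t = of_int n" using i(1) by (rule Ints_cases)
    have "x = of_int n - 2 * of_int l / 3" "t = of_int l / 3"
      by (auto simp: field_simps simp flip: l n)
    moreover have "y = of_int k / (6 * of_int d)"
      using d_nonzero by (simp flip: k)
    ultimately have "h = ?c n k l" unfolding hc comb_eq_iff by blast
    then show "h \<in> {?c n k l | n k l. True}" by blast
  next
    fix h assume "h \<in> {?c n k l | n k l. True}"
    then obtain n k l where h: "h = ?c n k l" by blast
    have "6 * of_int a * (of_int k / (6 * of_int d)) = (of_int (a' * k) :: complex)"
      using d_nonzero by (simp add: a')
    moreover have "of_int n - 2 * of_int l / 3 + 2 * (of_int l / 3) = (of_int n :: complex)"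
      by simp
    moreover have "of_int n - 2 * of_int l / 3 - of_int l / 3
        - 9 * of_int b * (of_int k / (6 * of_int d)) = (of_int (n - l - s * k) :: complex)"
      unfolding nine using d_nonzero by (simp add: field_simps)
    moreover have "of_int n - 2 * of_int l / 3 - of_int l / 3
        + 9 * of_int b * (of_int k / (6 * of_int d)) = (of_int (n - l + s * k) :: complex)"
      unfolding nine using d_nonzero by (simp add: field_simps)
    ultimately show "h \<in> A"
      unfolding h comb_mem_A_iff [OF three] by (simp only: Ints_of_int) simp
  qed
  moreover have "n = 0 \<and> k = 0 \<and> l = 0" if "?c n k l = 0" for n k l
    using that d_nonzero by (auto simp: comb_eq_0_iff)
  ultimately show ?thesis
    unfolding basis_of_vector_3 [OF module_scl_int] lin by blast
qed

lemma gen_index_A: "gen_index A (vector [comb 1 0 0, comb 0 1 0, comb 0 0 1] :: _ ^ 3) = 18 * of_int d"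
proof (cases "even m")
  case True
  \<comment> \<open>Row three says that \<open>w3\<close> is twice the first basis vector plus three
    times the third.\<close>
  let ?P = "vector [vector [1, 0, 0], vector [0, 6 * of_int d, 0], vector [2, 0, 3]] :: rat ^ 3 ^ 3"
  have "gen_index A (vector [comb 1 0 0, comb 0 1 0, comb 0 0 1] :: _ ^ 3) = \<bar>det ?P\<bar>"
  proof (rule gen_index_eq [OF Z_basis_even [OF True]])
    show "(vector [comb 1 0 0, comb 0 1 0, comb 0 0 1] :: _ ^ 3) $ i =
      (\<Sum>j\<in>UNIV. scl (of_rat (?P $ i $ j)) ((vector [comb 1 0 0, comb 0 (1 / (6 * of_int d)) 0,
        comb (- 2 / 3) 0 (1 / 3)] :: _ ^ 3) $ j))" for i
      using exhaust_3 [of i] d_nonzero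
      by (auto simp: sum_3 comb_scl comb_add comb_eq_iff of_rat_mult)
  qed
  then show ?thesis by (simp add: det_3 d)
next
  case False
  \<comment> \<open>The third basis vector now involves \<open>w2\<close>, which the entry 3 in the
    last row compensates. The determinant is again \<open>18 * d\<close>, and \<open>d\<close> is
    nonnegative as a gcd.\<close>
  let ?P = "vector [vector [1, 0, 0], vector [0, 3 * of_int d, 0], vector [2, 3, 6]] :: rat ^ 3 ^ 3"
  have "gen_index A (vector [comb 1 0 0, comb 0 1 0, comb 0 0 1] :: _ ^ 3) = \<bar>det ?P\<bar>"
  proof (rule gen_index_eq [OF Z_basis_odd [OF False]])
    show "(vector [comb 1 0 0, comb 0 1 0, comb 0 0 1] :: _ ^ 3) $ i =
      (\<Sum>j\<in>UNIV. scl (of_rat (?P $ i $ j)) ((vector [comb 1 0 0, comb 0 (1 / (3 * of_int d)) 0,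
        comb (- 1 / 3) (- 1 / (6 * of_int d)) (1 / 6)] :: _ ^ 3) $ j))" for i
      using exhaust_3 [of i] d_nonzero
      by (auto simp: sum_3 comb_scl comb_add comb_eq_iff of_rat_mult)
  qed
  then show ?thesis by (simp add: det_3 d)
qed

end

end

section \<open>The four cases from the valuations at 2 and 3\<close>

theorem corollary6p7:
  fixes a b g :: int
    and \<alpha> \<alpha>2 \<alpha>3 z :: complex
    and \<sigma> :: "complex \<Rightarrow> complex"
    and L Lt M :: "complex set"
    and G G' J :: "(complex \<Rightarrow> complex) set"
    and H A :: "((complex \<Rightarrow> complex) \<Rightarrow>\<^sub>0 complex) set"
    and w1 w2 w3 :: "(complex \<Rightarrow> complex) \<Rightarrow>\<^sub>0 complex"
    and W :: "((complex \<Rightarrow> complex) \<Rightarrow>\<^sub>0 complex) ^ 3"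
  assumes L: "L = Q_adjoin {\<alpha>}"
    and cubic: "Vector_Spaces.vector_space.dim (\<lambda>(q::rat) (x::complex). of_rat q * x) L = 3"
    and roots: "[:of_int b, - of_int a, 0, 1:] = [:-\<alpha>, 1:] * [:-\<alpha>2, 1:] * [:-\<alpha>3, 1:]"
    and reduced: "\<And>p::nat. Factorial_Ring.prime p \<Longrightarrow> vp p a < 2 \<or> vp p b < 3"
    and g: "g = gcd a b"
    and Lt: "Lt = normal_closure L"
    and G: "G = Gal Lt \<rat>"
    and G': "G' = Gal Lt L"
    and z: "z ^ 2 = of_int (4 * a ^ 3 - 27 * b ^ 2)"
    and M: "M = Q_adjoin {z}"
    and \<sigma>: "\<sigma> \<in> G" "\<sigma> \<alpha> = \<alpha>2" "\<sigma> \<alpha>2 = \<alpha>3" "\<sigma> \<alpha>3 = \<alpha>"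
    and J: "J = generate (BijGroup Lt) {\<sigma>}"
    and H: "H = fixed_algebra Lt M J G'"
    and w1: "w1 = Poly_Mapping.single \<one>\<^bsub>BijGroup Lt\<^esub> 1"
    and w2: "w2 = scl z (Poly_Mapping.single \<sigma> 1 - Poly_Mapping.single (\<sigma> [^]\<^bsub>BijGroup Lt\<^esub> (2::nat)) 1)"
    and w3: "w3 = Poly_Mapping.single \<sigma> 1 + Poly_Mapping.single (\<sigma> [^]\<^bsub>BijGroup Lt\<^esub> (2::nat)) 1"
    and W: "W = vector [w1, w2, w3]"
    and integral: "integral_basis (vector [1, \<alpha>, \<alpha> ^ 2] :: complex ^ 3) L"
    and three: "3 dvd a"
    and A: "A = associated_order H (Z_adjoin \<alpha>)"
  shows "Q_basis W H \<and>
     (vp 2 a \<ge> vp 2 b \<and> vp 3 a \<le> vp 3 b \<longrightarrow>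
           gen_index A W = 18 * of_int g \<and>
           Z_basis (vector [w1, scl (1 / (3 * of_int g)) w2,
             scl (1 / (6 * of_int g)) (scl (- 2 * of_int g) w1 - w2 + scl (of_int g) w3)]
             :: ((complex \<Rightarrow> complex) \<Rightarrow>\<^sub>0 complex) ^ 3) A) \<and>
     (vp 2 a < vp 2 b \<and> vp 3 a \<le> vp 3 b \<longrightarrow>
           gen_index A W = 18 * of_int g \<and>
           Z_basis (vector [w1, scl (1 / (6 * of_int g)) w2,
             scl (1 / 3) (scl (- 2) w1 + w3)]
             :: ((complex \<Rightarrow> complex) \<Rightarrow>\<^sub>0 complex) ^ 3) A) \<and>
     (vp 2 a \<ge> vp 2 b \<and> vp 3 a > vp 3 b \<longrightarrow>
           gen_index A W = 54 * of_int g \<and>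
           Z_basis (vector [w1, scl (1 / (9 * of_int g)) w2,
             scl (1 / (18 * of_int g)) (scl (- 6 * of_int g) w1 - w2 + scl (3 * of_int g) w3)]
             :: ((complex \<Rightarrow> complex) \<Rightarrow>\<^sub>0 complex) ^ 3) A) \<and>
     (vp 2 a < vp 2 b \<and> vp 3 a > vp 3 b \<longrightarrow>
           gen_index A W = 54 * of_int g \<and>
           Z_basis (vector [w1, scl (1 / (18 * of_int g)) w2,
             scl (1 / 3) (scl (- 2) w1 + w3)]
             :: ((complex \<Rightarrow> complex) \<Rightarrow>\<^sub>0 complex) ^ 3) A)"
proof -
  have indep_int: "\<forall>p q r :: int. of_int p * 1 + of_int q * \<alpha> + of_int r * \<alpha> ^ 2 = 0 \<longrightarrow> p = 0 \<and> q = 0 \<and> r = 0"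
    using integral unfolding basis_of_vector_3 [OF module_complex_int] by blast
  interpret cubic_roots a b \<alpha> \<alpha>2 \<alpha>3 z \<sigma> L Lt
  proof
    fix p q r :: complex
    assume "p \<in> \<rat>" "q \<in> \<rat>" "r \<in> \<rat>" and 0: "p + q * \<alpha> + r * \<alpha> ^ 2 = 0"
    then obtain p' q' r' where pqr: "p = of_rat p'" "q = of_rat q'" "r = of_rat r'"
      by (auto elim!: Rats_cases)
    \<comment> \<open>A common denominator reduces rational relations to the integral ones excluded
      by the integral basis.\<close>
    obtain N and k :: "3 \<Rightarrow> int" where N: "N > 0"
      and k: "\<And>i. of_int N * (if i = 1 then p' else if i = 2 then q' else r') = of_int (k i)"
      using common_denominator [of "\<lambda>i :: 3. if i = 1 then p' else if i = 2 then q' else r'"] by blast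
    have "of_rat (of_int N * p') = (of_rat (of_int (k 1)) :: complex)"
      "of_rat (of_int N * q') = (of_rat (of_int (k 2)) :: complex)"
      "of_rat (of_int N * r') = (of_rat (of_int (k 3)) :: complex)"
      using k [of 1] k [of 2] k [of 3] by simp_all
    then have N_mult: "of_int (k 1) = of_int N * p" "of_int (k 2) = of_int N * q" "of_int (k 3) = of_int N * r"
      by (simp_all add: pqr of_rat_mult)
    have "of_int (k 1) * 1 + of_int (k 2) * \<alpha> + of_int (k 3) * \<alpha> ^ 2 = of_int N * (p + q * \<alpha> + r * \<alpha> ^ 2)"
      unfolding N_mult by (simp add: algebra_simps)
    then have "k 1 = 0 \<and> k 2 = 0 \<and> k 3 = 0" using indep_int 0 by simp
    then show "p = 0 \<and> q = 0 \<and> r = 0" using N_mult N by simp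
  qed (use L Lt roots z \<sigma> G in simp_all)
  have H': "H = fixed_algebra Lt (Q_adjoin {z}) (generate B {\<sigma>}) (Gal Lt L)"
    by (simp only: H M J G')
  have A': "A = associated_order (fixed_algebra Lt (Q_adjoin {z}) (generate B {\<sigma>}) (Gal Lt L)) (Z_adjoin \<alpha>)"
    by (simp only: A H')
  have w1': "w1 = comb 1 0 0" and w2': "w2 = comb 0 1 0" and w3': "w3 = comb 0 0 1"
    by (auto intro!: poly_mapping_eqI
        simp: w1 w2 w3 comb_def tri_def lookup_add lookup_minus lookup_single when_def)
  define d where "d = gcd a (3 * b)"
  have "d dvd 3 * b" by (simp add: d_def)
  then obtain m where m: "3 * b = d * m" by (rule dvdE)
  note Z_basis_cases = Z_basis_odd [OF three d_def m] Z_basis_even [OF three d_def m]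
  have d_nz: "d \<noteq> 0" by (rule d_nonzero [OF three d_def m])
  have Q: "Q_basis W H" unfolding W H' w1' w2' w3' by (rule Q_basis_H)
  have index: "gen_index A W = 18 * of_int d"
    unfolding A' W w1' w2' w3' by (rule gen_index_A [OF three d_def m])
  have odd: "Z_basis (vector [w1, scl (1 / (3 * of_int d)) w2,
      scl (1 / (6 * of_int d)) (scl (- 2 * of_int d) w1 - w2 + scl (of_int d) w3)]
      :: ((complex \<Rightarrow> complex) \<Rightarrow>\<^sub>0 complex) ^ 3) A" if "vp 2 b \<le> vp 2 a"
    using Z_basis_cases(1) [OF odd_cofactor_of_vp_le [OF b_nonzero that m [unfolded d_def]]] d_nz
    unfolding A' w1' w2' w3' by (simp add: comb_scl comb_add comb_diff)
  have even: "Z_basis (vector [w1, scl (1 / (6 * of_int d)) w2, scl (1 / 3) (scl (- 2) w1 + w3)]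
      :: ((complex \<Rightarrow> complex) \<Rightarrow>\<^sub>0 complex) ^ 3) A" if "vp 2 a < vp 2 b"
    using Z_basis_cases(2) [OF even_cofactor_of_vp_less [OF that m [unfolded d_def]]]
    unfolding A' w1' w2' w3' by (simp add: comb_scl comb_add)
  have prime_3: "Factorial_Ring.prime (3 :: nat)" by simp
  have d_le: "d = g" if "vp 3 a \<le> vp 3 b"
  proof -
    \<comment> \<open>For \<open>a = 0\<close> the valuation would be infinite, while that of the
      nonzero \<open>b\<close> is finite.\<close>
    have "a \<noteq> 0" using that b_nonzero by (auto simp: vp_def)
    then show ?thesis using gcd_mult_prime_of_vp_le [OF prime_3 _ that] by (simp add: d_def g)
  qed
  \<comment> \<open>Substituting \<open>3 * g\<close> for \<open>d\<close> turns the index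
    \<open>18 * d\<close> into \<open>54 * g\<close> and the denominators \<open>3 * d\<close>,
    \<open>6 * d\<close> into \<open>9 * g\<close>, \<open>18 * g\<close>.\<close>
  have d_less: "d = 3 * g" if "vp 3 b < vp 3 a"
    using gcd_mult_prime_of_vp_less [OF prime_3 that] by (simp add: d_def g)
  show ?thesis
  proof (intro conjI impI; (elim conjE)?)
    show "Q_basis W H" by (rule Q)
  next
    assume "vp 2 b \<le> vp 2 a" "vp 3 a \<le> vp 3 b"
    then show "gen_index A W = 18 * of_int g" using index d_le by simp
  next
    assume "vp 2 b \<le> vp 2 a" "vp 3 a \<le> vp 3 b"
    then show "Z_basis (vector [w1, scl (1 / (3 * of_int g)) w2,
        scl (1 / (6 * of_int g)) (scl (- 2 * of_int g) w1 - w2 + scl (of_int g) w3)]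
        :: ((complex \<Rightarrow> complex) \<Rightarrow>\<^sub>0 complex) ^ 3) A" using odd d_le by simp
  next
    assume "vp 2 a < vp 2 b" "vp 3 a \<le> vp 3 b"
    then show "gen_index A W = 18 * of_int g" using index d_le by simp
  next
    assume "vp 2 a < vp 2 b" "vp 3 a \<le> vp 3 b"
    then show "Z_basis (vector [w1, scl (1 / (6 * of_int g)) w2, scl (1 / 3) (scl (- 2) w1 + w3)]
        :: ((complex \<Rightarrow> complex) \<Rightarrow>\<^sub>0 complex) ^ 3) A" using even d_le by simp
  next
    assume "vp 2 b \<le> vp 2 a" "vp 3 b < vp 3 a"
    then show "gen_index A W = 54 * of_int g" using index d_less by simp
  next
    assume "vp 2 b \<le> vp 2 a" "vp 3 b < vp 3 a"
    then show "Z_basis (vector [w1, scl (1 / (9 * of_int g)) w2,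
        scl (1 / (18 * of_int g)) (scl (- 6 * of_int g) w1 - w2 + scl (3 * of_int g) w3)]
        :: ((complex \<Rightarrow> complex) \<Rightarrow>\<^sub>0 complex) ^ 3) A" using odd d_less by simp
  next
    assume "vp 2 a < vp 2 b" "vp 3 b < vp 3 a"
    then show "gen_index A W = 54 * of_int g" using index d_less by simp
  next
    assume "vp 2 a < vp 2 b" "vp 3 b < vp 3 a"
    then show "Z_basis (vector [w1, scl (1 / (18 * of_int g)) w2, scl (1 / 3) (scl (- 2) w1 + w3)]
        :: ((complex \<Rightarrow> complex) \<Rightarrow>\<^sub>0 complex) ^ 3) A" using even d_less by simp
  qed
qed

end
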